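(* Let $N\ge 1$ and let $$g(t)=\sum_{k=1}^N \frac{a_k}{t-iw_k},\qquad a_k>0,\ w_k>0 \ (k=1,\dots,N).$$ Then the frame set of $g$ is $$\mathcal{F}(g)=\{(\alpha,\beta):\ \alpha>0,\ \beta>0,\ \alpha\beta\le 1\}.$$
   Context: For $g\in L^2(\mathbb{R})$ and $\alpha,\beta>0$ the Gabor system is $\mathcal{G}(g;\alpha,\beta)=\{e^{2\pi i\beta n t}g(t-\alpha m)\}_{m,n\in\mathbb{Z}}$. It is a frame in $L^2(\mathbb{R})$ if there are constants $0<A\le B<\infty$ with $A\|f\|^2\le\sum_{m,n}|\langle f, e^{2\pi i\beta n\cdot}g(\cdot-\alpha m)\rangle|^2\le B\|f\|^2$ for all $f\in L^2(\mathbb{R})$. The frame set is $\mathcal{F}(g)=\{(\alpha,\beta):\alpha,\beta>0,\ \mathcal{G}(g;\alpha,\beta)\text{ is a frame in }L^2(\mathbb{R})\}$. *)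

theory Defs
  imports "HOL-Analysis.Analysis"
begin

definition L2 :: "(real \<Rightarrow> complex) set" where
  "L2 = {f. f \<in> borel_measurable lborel \<and> integrable lborel (\<lambda>t. (norm (f t))\<^sup>2)}"

definition L2_inner :: "(real \<Rightarrow> complex) \<Rightarrow> (real \<Rightarrow> complex) \<Rightarrow> complex" where
  "L2_inner f h = (LINT t|lborel. f t * cnj (h t))"

definition L2_norm_sq :: "(real \<Rightarrow> complex) \<Rightarrow> real" where
  "L2_norm_sq f = (LINT t|lborel. (norm (f t))\<^sup>2)"

definition gabor_atom :: "(real \<Rightarrow> complex) \<Rightarrow> real \<Rightarrow> real \<Rightarrow> int \<Rightarrow> int \<Rightarrow> real \<Rightarrow> complex" where
  "gabor_atom g \<alpha> \<beta> m n t =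
     exp (2 * of_real pi * \<i> * of_real (\<beta> * of_int n * t)) * g (t - \<alpha> * of_int m)"

definition gabor_frame :: "(real \<Rightarrow> complex) \<Rightarrow> real \<Rightarrow> real \<Rightarrow> bool" where
  "gabor_frame g \<alpha> \<beta> \<longleftrightarrow>
     (\<exists>A B. 0 < A \<and> A \<le> B \<and>
        (\<forall>f\<in>L2.
           (\<lambda>(m,n). (norm (L2_inner f (gabor_atom g \<alpha> \<beta> m n)))\<^sup>2) summable_on (UNIV :: (int \<times> int) set) \<and>
           A * L2_norm_sq f \<le> (\<Sum>\<^sub>\<infinity>(m,n)\<in>(UNIV :: (int \<times> int) set). (norm (L2_inner f (gabor_atom g \<alpha> \<beta> m n)))\<^sup>2) \<and>
           (\<Sum>\<^sub>\<infinity>(m,n)\<in>(UNIV :: (int \<times> int) set). (norm (L2_inner f (gabor_atom g \<alpha> \<beta> m n)))\<^sup>2) \<le> B * L2_norm_sq f))"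

definition frame_set :: "(real \<Rightarrow> complex) \<Rightarrow> (real \<times> real) set" where
  "frame_set g = {(\<alpha>, \<beta>). 0 < \<alpha> \<and> 0 < \<beta> \<and> gabor_frame g \<alpha> \<beta>}"

end

theory Submission
  imports Defs
begin

text \<open>
  Put \<open>L = 1/\<beta>\<close>. By Parseval on \<open>[0, L)\<close> the modulations can be summed out, and the frame
  inequality becomes a two-sided bound, uniform in \<open>t\<close>, for the maps
  \<open>c \<mapsto> y\<close>, \<open>y m = \<Sum>j. c j g(t + j L - \<alpha> m)\<close> on square-summable sequences. For finite \<open>c\<close> the numbers
  \<open>y m\<close> are Fourier coefficients on \<open>[0, 1/\<alpha>]\<close> of the function
  \<open>U(\<xi>) = \<Sum>k. a k exp(-2\<pi> w k \<xi>) v k \<xi>\<close>, where \<open>v k\<close> solves \<open>v k \<xi> - r k v k (\<xi> + 1/\<alpha>) = D \<xi>\<close>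
  with \<open>D \<xi> = \<Sum>j. c j exp(-2\<pi>i(t + j L)\<xi>)\<close> and \<open>r k = exp(-2\<pi> w k/\<alpha>)\<close>. Since \<open>|v k|\<close> is \<open>\<beta>\<close>-periodic
  and the exponential weight decreases, testing \<open>U\<close> against \<open>D\<close> over \<open>[0, \<beta>]\<close>, which lies in
  \<open>[0, 1/\<alpha>]\<close> exactly when \<open>\<alpha>\<beta> \<le> 1\<close>, gives a positive contribution from every pole. As all \<open>a k\<close> are
  positive these contributions cannot cancel, which is the lower frame bound.

  If \<open>\<alpha>\<beta> > 1\<close>, counting dimensions yields a finite \<open>c \<noteq> 0\<close> which makes \<open>y m\<close> vanish for all \<open>m\<close> in the
  relevant window and whose first \<open>p\<close> moments vanish. Expanding \<open>1/(x - z)\<close> in powers of \<open>x/z\<close>, the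
  remaining \<open>y m\<close> are geometrically small in \<open>p\<close>, so no lower frame bound can hold.
\<close>

section \<open>Parseval's identity on a period\<close>

text \<open>The function \<open>U\<close> is forced. Since \<open>1/(x - iw)\<close> is
  \<open>2\<pi>i\<close> times the integral of \<open>exp(-2\<pi>w\<xi> - 2\<pi>ix\<xi>)\<close>
  over \<xi> > 0, every \<open>y m\<close> is a Fourier integral over a half-line. Folding it modulo
  \<open>1/\<alpha>\<close> produces \<open>exp(-2\<pi> w k \<xi>)\<close> times the geometric
  series of the terms \<open>(r k)^l D(\<xi> + l/\<alpha>)\<close>. That series is
  \<open>v k\<close>, and the difference equation is its telescoping. The sign of each pole's
  contribution rests on one count. The shifted term in the test carries \<open>r^2\<close>, while
  moving a \<beta>-periodic function by \<open>1/\<alpha>\<close> under the weight costs at most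
  \<open>exp(2\<pi>w/\<alpha>) = 1/r\<close>. The net factor is \<open>r < 1\<close>, so a share
  \<open>1 - r\<close> survives for every pole. All constants are independent of \<open>t\<close>
  and of the support of \<open>c\<close>, which lets the bounds pass to square-summable sequences.
  In the sparse case, annihilating finitely many \<open>y m\<close> alone gives no control of the
  infinitely many others; hence the moments. Their number is a small fixed fraction of the number of
  unknowns, so the surplus of unknowns pays for both kinds of equations. They are solved at
  \<open>t = 0\<close> only, and continuity supplies an interval of \<open>t\<close> on which a step
  function can live.\<close>

abbreviation period_measure :: "real \<Rightarrow> real measure" where
  "period_measure L \<equiv> restrict_space lborel {0..<L}"

lemma finite_measure_period: "finite_measure (period_measure L)"
proof (rule finite_measureI)
  have "emeasure lborel {0..<L} \<le> emeasure lborel {0..L}"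
    by (rule emeasure_mono) auto
  also have "\<dots> < \<infinity>" by (simp add: emeasure_lborel_Icc_eq)
  finally show "emeasure (period_measure L) (space (period_measure L)) \<noteq> \<infinity>"
    by (simp add: emeasure_restrict_space)
qed

lemma space_period [simp]: "space (period_measure L) = {0..<L}"
  by (simp add: space_restrict_space)

text \<open>Continuous integrands are evaluated by the fundamental theorem of calculus on a closed
  interval; dropping the endpoint \<open>L\<close>, so that translates tile the line, changes
  nothing.\<close>

lemma period_integral_continuous:
  fixes f :: "real \<Rightarrow> 'a::euclidean_space"
  assumes "continuous_on {0..L} f"
  shows "integrable (period_measure L) f" "(LINT x|period_measure L. f x) = integral {0..L} f"
proof -
  have s: "set_integrable lborel {0..L} f"
    using assms by (rule borel_integrable_atLeastAtMost')
  then have s': "set_integrable lborel {0..<L} f"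
    by (rule set_integrable_subset) auto
  then show "integrable (period_measure L) f"
    by (simp add: integrable_restrict_space set_integrable_def)
  have "(LINT x|period_measure L. f x) = (LINT x:{0..<L}|lborel. f x)"
    by (simp add: integral_restrict_space set_lebesgue_integral_def)
  also have "\<dots> = integral {0..<L} f"
    by (rule set_borel_integral_eq_integral(2)[OF s'])
  also have "\<dots> = integral {0..L} f"
    by (rule integral_subset_negligible) (auto intro: negligible_subset[of "{L}"])
  finally show "(LINT x|period_measure L. f x) = integral {0..L} f" .
qed

section \<open>Harmonics and the error of trigonometric approximation\<close>

definition harmonic :: "real \<Rightarrow> int \<Rightarrow> real \<Rightarrow> complex" where
  "harmonic L n x = cis (2 * pi * of_int n * x / L)"

lemma norm_harmonic [simp]: "norm (harmonic L n x) = 1"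
  by (simp add: harmonic_def)

lemma continuous_harmonic [continuous_intros]: "continuous_on S (harmonic L n)"
  unfolding harmonic_def[abs_def] cis_conv_exp divide_inverse by (intro continuous_intros)

lemma measurable_harmonic [measurable]: "harmonic L n \<in> borel_measurable borel"
  by (rule borel_measurable_continuous_onI) (rule continuous_harmonic)

lemma harmonic_mult: "harmonic L n x * harmonic L m x = harmonic L (n + m) x"
  by (simp add: harmonic_def cis_mult add_divide_distrib ring_distribs)

lemma cnj_harmonic: "cnj (harmonic L n x) = harmonic L (- n) x"
  by (simp add: harmonic_def cis_cnj)

lemma integral_exp_linear:
  fixes z :: complex
  assumes "z \<noteq> 0" "a \<le> b"
  shows "integral {a..b} (\<lambda>x. exp (z * of_real x)) = (exp (z * of_real b) - exp (z * of_real a)) / z"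
proof -
  have "((\<lambda>x. exp (z * of_real x)) has_integral
      (exp (z * of_real b) / z - exp (z * of_real a) / z)) {a..b}"
    using assms
    by (intro fundamental_theorem_of_calculus)
       (auto intro!: derivative_eq_intros has_vector_derivative_real_field simp: field_simps)
  then show ?thesis
    by (simp add: integral_unique diff_divide_distrib)
qed

lemma integral_harmonic:
  assumes "L > 0"
  shows "integral {0..L} (harmonic L n) = (if n = 0 then of_real L else 0)"
proof (cases "n = 0")
  case True
  then show ?thesis using assms by (simp add: harmonic_def[abs_def] scaleR_conv_of_real)
next
  case False
  let ?z = "2 * of_real pi * of_int n * \<i> / of_real L :: complex"
  have "harmonic L n = (\<lambda>x. exp (?z * of_real x))"
    by (auto simp: harmonic_def cis_conv_exp field_simps)
  moreover have "exp (?z * of_real L) = 1"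
    using assms exp_integer_2pi[of "of_int n"] by (simp add: field_simps)
  ultimately show ?thesis
    using integral_exp_linear[of ?z 0 L] assms False by simp
qed

lemma integrable_norm_sq_mult:
  fixes f h :: "'a \<Rightarrow> complex"
  assumes [measurable]: "f \<in> borel_measurable M" "h \<in> borel_measurable M"
    and "integrable M (\<lambda>x. (norm (f x))\<^sup>2)" "integrable M (\<lambda>x. (norm (h x))\<^sup>2)"
  shows "integrable M (\<lambda>x. f x * h x)"
proof (rule Bochner_Integration.integrable_bound)
  show "integrable M (\<lambda>x. (norm (f x))\<^sup>2 + (norm (h x))\<^sup>2)"
    using assms by simp
  show "AE x in M. norm (f x * h x) \<le> norm ((norm (f x))\<^sup>2 + (norm (h x))\<^sup>2)"
  proof (rule AE_I2)
    fix x
    have "norm (f x) * norm (h x) \<le> (norm (f x))\<^sup>2 + (norm (h x))\<^sup>2"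
      using sum_squares_bound[of "norm (f x)" "norm (h x)"]
        mult_nonneg_nonneg[OF norm_ge_zero[of "f x"] norm_ge_zero[of "h x"]] by linarith
    then show "norm (f x * h x) \<le> norm ((norm (f x))\<^sup>2 + (norm (h x))\<^sup>2)"
      by (simp add: norm_mult)
  qed
qed measurable

lemma integrable_norm_sq_add:
  fixes f h :: "'a \<Rightarrow> complex"
  assumes [measurable]: "f \<in> borel_measurable M" "h \<in> borel_measurable M"
    and "integrable M (\<lambda>x. (norm (f x))\<^sup>2)" "integrable M (\<lambda>x. (norm (h x))\<^sup>2)"
  shows "integrable M (\<lambda>x. (norm (f x + h x))\<^sup>2)"
    and "(LINT x|M. (norm (f x + h x))\<^sup>2) \<le> 2 * (LINT x|M. (norm (f x))\<^sup>2) + 2 * (LINT x|M. (norm (h x))\<^sup>2)"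
proof -
  have le: "(norm (f x + h x))\<^sup>2 \<le> 2 * (norm (f x))\<^sup>2 + 2 * (norm (h x))\<^sup>2" for x
  proof -
    have "(norm (f x + h x))\<^sup>2 \<le> (norm (f x) + norm (h x))\<^sup>2"
      by (simp add: norm_triangle_ineq power_mono)
    also have "\<dots> \<le> 2 * (norm (f x))\<^sup>2 + 2 * (norm (h x))\<^sup>2"
      using sum_squares_bound[of "norm (f x)" "norm (h x)"] by (simp add: power2_sum)
    finally show ?thesis .
  qed
  have i: "integrable M (\<lambda>x. 2 * (norm (f x))\<^sup>2 + 2 * (norm (h x))\<^sup>2)"
    using assms by simp
  show *: "integrable M (\<lambda>x. (norm (f x + h x))\<^sup>2)"
    by (rule Bochner_Integration.integrable_bound[OF i]) (auto simp: le)
  have "(LINT x|M. (norm (f x + h x))\<^sup>2) \<le> (LINT x|M. 2 * (norm (f x))\<^sup>2 + 2 * (norm (h x))\<^sup>2)"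
    by (rule integral_mono[OF * i]) (rule le)
  then show "(LINT x|M. (norm (f x + h x))\<^sup>2) \<le> 2 * (LINT x|M. (norm (f x))\<^sup>2) + 2 * (LINT x|M. (norm (h x))\<^sup>2)"
    using assms by simp
qed

definition fourier_coeff :: "real \<Rightarrow> (real \<Rightarrow> complex) \<Rightarrow> int \<Rightarrow> complex" where
  "fourier_coeff L u n = (LINT x|period_measure L. u x * cnj (harmonic L n x))"

text \<open>Completing the square separately in each \<open>d n\<close>, by orthogonality. One
  identity has three uses: \<open>d n\<close> equal to the coefficient over \<open>L\<close> gives
  Bessel, arbitrary \<open>d\<close> bounds the defect in Bessel, and \<open>u = 0\<close> gives the
  norm of a trigonometric polynomial. The division by \<open>L\<close> appears because
  \<open>fourier_coeff\<close> is not normalized.\<close>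

lemma trig_approximation_error:
  fixes u :: "real \<Rightarrow> complex"
  assumes L: "L > 0" and F: "finite F"
    and u [measurable]: "u \<in> borel_measurable (period_measure L)"
    and u2: "integrable (period_measure L) (\<lambda>x. (norm (u x))\<^sup>2)"
  shows "(LINT x|period_measure L. (norm (u x - (\<Sum>n\<in>F. d n * harmonic L n x)))\<^sup>2)
     = (LINT x|period_measure L. (norm (u x))\<^sup>2) - (\<Sum>n\<in>F. (norm (fourier_coeff L u n))\<^sup>2) / L
       + L * (\<Sum>n\<in>F. (norm (d n - fourier_coeff L u n / L))\<^sup>2)"
proof -
  let ?M = "period_measure L"
  define T where "T x = (\<Sum>n\<in>F. d n * harmonic L n x)" for x
  have T_cont: "continuous_on S T" for S
    unfolding T_def by (intro continuous_intros)
  have T_meas [measurable]: "T \<in> borel_measurable borel"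
    by (rule borel_measurable_continuous_onI) (rule T_cont)
  have hM [measurable]: "harmonic L n \<in> borel_measurable ?M" for n
    by (rule measurable_restrict_space1) simp
  have chM: "(\<lambda>x. cnj (harmonic L n x)) \<in> borel_measurable ?M" for n
    unfolding cnj_harmonic by (rule hM)
  have TM [measurable]: "T \<in> borel_measurable ?M"
    by (rule measurable_restrict_space1) simp
  have h2: "integrable ?M (\<lambda>x. (norm (cnj (harmonic L n x)))\<^sup>2)" for n
    using period_integral_continuous(1)[of L "\<lambda>x. 1::real"] by simp
  have uh: "integrable ?M (\<lambda>x. u x * cnj (harmonic L n x))" for n
    by (rule integrable_norm_sq_mult[OF u chM u2 h2])
  have uT: "u x * cnj (T x) = (\<Sum>n\<in>F. cnj (d n) * (u x * cnj (harmonic L n x)))" for x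
    by (simp add: T_def sum_distrib_left mult_ac)
  have I1: "(LINT x|?M. u x * cnj (T x)) = (\<Sum>n\<in>F. cnj (d n) * fourier_coeff L u n)"
    unfolding uT fourier_coeff_def using uh by (subst Bochner_Integration.integral_sum) auto
  have i1: "integrable ?M (\<lambda>x. u x * cnj (T x))"
    unfolding uT using uh by auto
  have hh: "integral {0..L} (\<lambda>x. harmonic L n x * cnj (harmonic L m x)) = (if n = m then of_real L else 0)" for n m
  proof -
    have "(\<lambda>x. harmonic L n x * cnj (harmonic L m x)) = harmonic L (n - m)"
      by (simp add: cnj_harmonic harmonic_mult fun_eq_iff)
    then show ?thesis using integral_harmonic[OF L, of "n - m"] by simp
  qed
  have ihh: "integrable ?M (\<lambda>x. harmonic L n x * cnj (harmonic L m x))"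
      "(LINT x|?M. harmonic L n x * cnj (harmonic L m x)) = (if n = m then of_real L else 0)" for n m
    using period_integral_continuous[OF continuous_on_mult[OF continuous_harmonic continuous_on_cnj[OF continuous_harmonic]]] hh
    by auto
  have TT: "T x * cnj (T x) = (\<Sum>n\<in>F. \<Sum>m\<in>F. d n * cnj (d m) * (harmonic L n x * cnj (harmonic L m x)))" for x
    by (simp add: T_def sum_product mult_ac)
  have i2: "integrable ?M (\<lambda>x. T x * cnj (T x))"
    unfolding TT using ihh by auto
  have "(LINT x|?M. T x * cnj (T x)) = (\<Sum>n\<in>F. \<Sum>m\<in>F. d n * cnj (d m) * (if n = m then of_real L else 0))"
    unfolding TT using ihh by (subst Bochner_Integration.integral_sum; (subst Bochner_Integration.integral_sum)?; auto)
  also have "\<dots> = of_real L * (\<Sum>n\<in>F. d n * cnj (d n))"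
    using F by (simp add: if_distrib sum.delta sum_distrib_left mult_ac cong: if_cong)
  finally have I2: "(LINT x|?M. T x * cnj (T x)) = of_real L * (\<Sum>n\<in>F. d n * cnj (d n))" .
  have sq: "(norm (u x - T x))\<^sup>2 = (norm (u x))\<^sup>2 - 2 * Re (u x * cnj (T x)) + Re (T x * cnj (T x))" for x
    unfolding cmod_power2 by (simp add: power2_eq_square algebra_simps)
  have "(LINT x|?M. (norm (u x - T x))\<^sup>2) =
     (LINT x|?M. (norm (u x))\<^sup>2) - 2 * Re (LINT x|?M. u x * cnj (T x)) + Re (LINT x|?M. T x * cnj (T x))"
    unfolding sq using u2 i1 i2 by (simp del: times_complex.sel)
  also have "\<dots> = (LINT x|?M. (norm (u x))\<^sup>2) +
      (\<Sum>n\<in>F. - 2 * Re (cnj (d n) * fourier_coeff L u n) + L * (norm (d n))\<^sup>2)"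
  proof -
    have "Re (of_real L * (\<Sum>n\<in>F. d n * cnj (d n))) = L * (\<Sum>n\<in>F. (norm (d n))\<^sup>2)"
      unfolding cmod_power2 by (simp add: power2_eq_square)
    then show ?thesis
      unfolding I1 I2
      by (simp add: sum_subtractf sum_distrib_left del: times_complex.sel)
  qed
  also have "(\<Sum>n\<in>F. - 2 * Re (cnj (d n) * fourier_coeff L u n) + L * (norm (d n))\<^sup>2)
     = (\<Sum>n\<in>F. L * (norm (d n - fourier_coeff L u n / L))\<^sup>2 - (norm (fourier_coeff L u n))\<^sup>2 / L)"
  proof (rule sum.cong[OF refl])
    fix n
    show "- 2 * Re (cnj (d n) * fourier_coeff L u n) + L * (norm (d n))\<^sup>2 =
       L * (norm (d n - fourier_coeff L u n / L))\<^sup>2 - (norm (fourier_coeff L u n))\<^sup>2 / L"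
      using L unfolding cmod_power2
      by (simp add: power2_eq_square field_simps)
  qed
  finally show ?thesis
    by (simp add: T_def sum_subtractf sum_distrib_left sum_divide_distrib)
qed

section \<open>Density of trigonometric polynomials\<close>

definition trig_polynomials :: "real \<Rightarrow> (real \<Rightarrow> complex) set" where
  "trig_polynomials L = {T. \<exists>F d. finite F \<and> T = (\<lambda>x. \<Sum>n\<in>F. d n * harmonic L n x)}"

lemma trig_polynomials_harmonic: "(\<lambda>x. c * harmonic L n x) \<in> trig_polynomials L"
  unfolding trig_polynomials_def by (intro CollectI exI[of _ "{n}"] exI[of _ "\<lambda>_. c"]) auto

lemma trig_polynomials_add:
  assumes "S \<in> trig_polynomials L" "T \<in> trig_polynomials L"
  shows "(\<lambda>x. S x + T x) \<in> trig_polynomials L"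
proof -
  obtain F d where F: "finite F" "S = (\<lambda>x. \<Sum>n\<in>F. d n * harmonic L n x)"
    using assms by (auto simp: trig_polynomials_def)
  obtain F' d' where F': "finite F'" "T = (\<lambda>x. \<Sum>n\<in>F'. d' n * harmonic L n x)"
    using assms by (auto simp: trig_polynomials_def)
  let ?d = "\<lambda>n. (if n \<in> F then d n else 0) + (if n \<in> F' then d' n else 0)"
  have "S x + T x = (\<Sum>n\<in>F \<union> F'. ?d n * harmonic L n x)" for x
  proof -
    have "S x = (\<Sum>n\<in>F \<union> F'. (if n \<in> F then d n else 0) * harmonic L n x)"
      unfolding F using F F' by (intro sum.mono_neutral_cong_left) auto
    moreover have "T x = (\<Sum>n\<in>F \<union> F'. (if n \<in> F' then d' n else 0) * harmonic L n x)"
      unfolding F' using F F' by (intro sum.mono_neutral_cong_left) auto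
    ultimately show ?thesis by (simp add: sum.distrib ring_distribs)
  qed
  then show ?thesis
    unfolding trig_polynomials_def using F F'
    by (intro CollectI exI[of _ "F \<union> F'"] exI[of _ ?d]) auto
qed

lemma trig_polynomials_sum:
  assumes "\<And>i. i \<in> I \<Longrightarrow> T i \<in> trig_polynomials L"
  shows "(\<lambda>x. \<Sum>i\<in>I. T i x) \<in> trig_polynomials L"
  using assms
proof (induction I rule: infinite_finite_induct)
  case (insert i I)
  then show ?case by (simp add: trig_polynomials_add)
qed (use trig_polynomials_harmonic[of 0 L 0] in auto)

lemma trig_polynomials_mult:
  assumes "S \<in> trig_polynomials L" "T \<in> trig_polynomials L"
  shows "(\<lambda>x. S x * T x) \<in> trig_polynomials L"
proof -
  obtain F d where F: "S = (\<lambda>x. \<Sum>n\<in>F. d n * harmonic L n x)"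
    using assms by (auto simp: trig_polynomials_def)
  obtain F' d' where F': "T = (\<lambda>x. \<Sum>n\<in>F'. d' n * harmonic L n x)"
    using assms by (auto simp: trig_polynomials_def)
  have "S x * T x = (\<Sum>n\<in>F. \<Sum>m\<in>F'. (d n * d' m) * harmonic L (n + m) x)" for x
    unfolding F F' by (simp add: sum_product flip: harmonic_mult) (simp add: mult_ac)
  then show ?thesis
    by (auto intro!: trig_polynomials_sum trig_polynomials_harmonic)
qed

text \<open>Induction on the polynomial. In the linear case a real-linear functional of
  \<open>cis\<close> is a combination of cosine and sine, hence of the harmonics \<open>1\<close>
  and \<open>-1\<close>.\<close>

lemma real_polynomial_circle_trig:
  assumes "real_polynomial_function p"
  shows "(\<lambda>x. of_real (p (cis (2 * pi * x / L)))) \<in> trig_polynomials L"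
  using assms
proof induction
  case (linear f)
  interpret bounded_linear f by fact
  have eq: "of_real (f (cis (2 * pi * x / L))) =
      (of_real (f 1) - \<i> * of_real (f \<i>)) / 2 * harmonic L 1 x +
      (of_real (f 1) + \<i> * of_real (f \<i>)) / 2 * harmonic L (-1) x" for x
  proof -
    have "cis (2 * pi * x / L) = cos (2 * pi * x / L) *\<^sub>R 1 + sin (2 * pi * x / L) *\<^sub>R \<i>"
      by (simp add: complex_eq_iff)
    then have "f (cis (2 * pi * x / L)) = cos (2 * pi * x / L) * f 1 + sin (2 * pi * x / L) * f \<i>"
      by (simp add: add scale)
    then show ?thesis
      by (simp add: harmonic_def complex_eq_iff field_simps)
  qed
  show ?case unfolding eq by (intro trig_polynomials_add trig_polynomials_harmonic)
next
  case (const c)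
  show ?case using trig_polynomials_harmonic[of "of_real c" L 0] by (simp add: harmonic_def)
next
  case (add f g)
  then show ?case by (simp add: trig_polynomials_add)
next
  case (mult f g)
  then show ?case by (simp add: trig_polynomials_mult)
qed

text \<open>The periodic function descends to the unit circle through \<open>Arg2pi\<close>.
  Stone-Weierstrass gives a polynomial there, and on the circle a polynomial is
  trigonometric.\<close>

lemma trig_uniform_approximation:
  fixes h :: "real \<Rightarrow> complex"
  assumes L: "L > 0" and h: "continuous_on {0..L} h" "h 0 = h L" and e: "e > 0"
  obtains T where "T \<in> trig_polynomials L" "\<And>x. x \<in> {0..<L} \<Longrightarrow> norm (h x - T x) < e"
proof -
  define p where "p t = h (L * t)" for t
  have "path p" unfolding path_def p_def
    by (rule continuous_on_compose2[OF h(1)]) (use L in \<open>auto intro!: continuous_intros mult_left_le\<close>)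
  moreover have "pathfinish p = pathstart p" using h by (simp add: pathfinish_def pathstart_def p_def)
  \<comment> \<open>\<open>Arg2pi\<close> jumps at the point 1. Viewing \<open>p\<close> as a loop
    homotopic to itself yields continuity of the descended function at that point too.\<close>
  ultimately have "homotopic_loops UNIV p p" by (simp add: homotopic_loops_refl)
  from homotopic_with_imp_continuous[OF homotopic_loops_imp_homotopic_circlemaps[OF this]]
  have "continuous_on (sphere 0 1) (p \<circ> (\<lambda>z. Arg2pi z / (2 * pi)))" by simp
  from Stone_Weierstrass_polynomial_function[OF compact_sphere this e]
  obtain q where q: "polynomial_function q"
     "\<And>z. z \<in> sphere 0 1 \<Longrightarrow> norm (p (Arg2pi z / (2 * pi)) - q z) < e"
    by auto
  have re: "real_polynomial_function (Re \<circ> q)" "real_polynomial_function (Im \<circ> q)"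
    using q(1) bounded_linear_Re bounded_linear_Im unfolding polynomial_function_def by blast+
  define T where "T x = q (cis (2 * pi * x / L))" for x
  have "T = (\<lambda>x. of_real ((Re \<circ> q) (cis (2 * pi * x / L))) +
         \<i> * harmonic L 0 x * of_real ((Im \<circ> q) (cis (2 * pi * x / L))))"
    by (auto simp: T_def complex_eq_iff harmonic_def)
  also have "\<dots> \<in> trig_polynomials L"
    by (intro trig_polynomials_add trig_polynomials_mult trig_polynomials_harmonic
         real_polynomial_circle_trig re)
  finally have "T \<in> trig_polynomials L" .
  moreover have "norm (h x - T x) < e" if x: "x \<in> {0..<L}" for x
  proof -
    have "Arg2pi (cis (2 * pi * x / L)) = 2 * pi * x / L"
      by (rule Arg2pi_unique[of 1]) (use x L in \<open>auto simp: cis_conv_exp field_simps\<close>)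
    then have "p (Arg2pi (cis (2 * pi * x / L)) / (2 * pi)) = h x"
      using L by (simp add: p_def)
    then show ?thesis using q(2)[of "cis (2 * pi * x / L)"] by (simp add: T_def)
  qed
  ultimately show ?thesis using that by blast
qed

lemma bounded_trig_pointwise_approximation:
  fixes u :: "real \<Rightarrow> complex"
  assumes L: "L > 0" and u: "u \<in> borel_measurable lborel" and K: "\<And>x. norm (u x) \<le> K"
  obtains T where "\<And>n. T n \<in> trig_polynomials L" "\<And>n x. x \<in> {0..<L} \<Longrightarrow> norm (T n x) \<le> K + 1"
    "AE x in period_measure L. (\<lambda>n. T n x) \<longlonglongrightarrow> u x"
proof -
  have K0: "K \<ge> 0" using K[of 0] norm_ge_zero order_trans by blast
  have "u measurable_on UNIV"
    by (rule lebesgue_measurable_imp_measurable_on) (use u in \<open>auto intro: measurable_completion\<close>)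
  then obtain N G where N: "negligible N" and Gc: "\<And>n. continuous_on UNIV (G n)"
    and G: "\<And>x. x \<notin> N \<Longrightarrow> (\<lambda>n. G n x) \<longlonglongrightarrow> u x"
    unfolding measurable_on_def by auto
  \<comment> \<open>Projection onto the disc of radius \<open>K\<close> bounds the approximants
    without changing their limit, since \<open>u\<close> takes its values in the disc.\<close>
  let ?cp = "closest_point (cball (0::complex) K)"
  have ccp: "continuous_on S ?cp" for S
    by (rule continuous_on_closest_point) (use K0 in auto)
  have ncp: "norm (?cp z) \<le> K" for z
    using closest_point_in_set[of "cball (0::complex) K" z] K0 by simp
  \<comment> \<open>The cutoff vanishes at \<open>0\<close> and \<open>L\<close>, which makes
    \<open>h n\<close> periodic, and equals 1 at an interior point once \<open>n\<close> is at least
    \<open>1 / min x (L - x)\<close>. Only the null set \<open>{0}\<close> of the period is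
    lost.\<close>
  define cut where "cut n x = max 0 (min 1 (real n * min x (L - x)))" for n x
  define h where "h n x = of_real (cut n x) * ?cp (G n x)" for n x
  have cut01: "0 \<le> cut n x" "cut n x \<le> 1" for n x by (auto simp: cut_def)
  have h_norm: "norm (h n x) \<le> K" for n x
    using mult_mono[OF cut01(2) ncp[of "G n x"]] cut01[of n x] by (simp add: h_def norm_mult)
  have hc: "continuous_on {0..L} (h n)" for n
    unfolding h_def cut_def
    by (intro continuous_intros continuous_on_compose2[OF ccp[of UNIV] continuous_on_subset[OF Gc]]) auto
  have h0: "h n 0 = h n L" for n using L by (simp add: h_def cut_def)
  have "\<exists>T. T \<in> trig_polynomials L \<and> (\<forall>x\<in>{0..<L}. norm (h n x - T x) < inverse (Suc n))" for n
    by (rule trig_uniform_approximation[OF L hc[of n] h0[of n], of "inverse (Suc n)"]) auto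
  then obtain T where T: "\<And>n. T n \<in> trig_polynomials L"
    "\<And>n x. x \<in> {0..<L} \<Longrightarrow> norm (h n x - T n x) < inverse (Suc n)"
    by metis
  have "norm (T n x) \<le> K + 1" if "x \<in> {0..<L}" for n x
  proof -
    have "norm (T n x) \<le> norm (h n x) + norm (h n x - T n x)"
      by (metis norm_minus_commute norm_triangle_sub)
    moreover have "inverse (real (Suc n)) \<le> 1" by (simp add: field_simps)
    ultimately show ?thesis using h_norm[of n x] T(2)[OF that, of n] by linarith
  qed
  moreover have "AE x in period_measure L. (\<lambda>n. T n x) \<longlonglongrightarrow> u x"
  proof -
    have "AE x in lebesgue. x \<notin> N"
      using N by (intro AE_not_in) (simp add: negligible_iff_null_sets)
    then have "AE x in lborel. x \<notin> N" by (simp add: AE_completion_iff)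
    moreover have "AE x in lborel. x \<noteq> 0" by (rule AE_lborel_singleton)
    ultimately have "AE x in lborel. x \<in> {0..<L} \<longrightarrow> (\<lambda>n. T n x) \<longlonglongrightarrow> u x"
    proof eventually_elim
      case (elim x)
      show ?case
      proof
        assume x: "x \<in> {0..<L}"
        have "(\<lambda>n. ?cp (G n x)) \<longlonglongrightarrow> ?cp (u x)"
          by (rule continuous_on_tendsto_compose[OF ccp[of UNIV] G]) (use elim in auto)
        moreover have "?cp (u x) = u x" by (rule closest_point_self) (use K in auto)
        moreover have "(\<lambda>n. of_real (cut n x) :: complex) \<longlonglongrightarrow> of_real 1"
        proof (rule tendsto_of_real, rule tendsto_eventually)
          have m: "min x (L - x) > 0" using x elim by auto
          have "\<forall>\<^sub>F n in sequentially. 1 / min x (L - x) \<le> real n"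
            using filterlim_real_sequentially by (rule filterlim_at_top[THEN iffD1, rule_format])
          then show "\<forall>\<^sub>F n in sequentially. cut n x = 1"
          proof eventually_elim
            case (elim n)
            then have "1 \<le> real n * min x (L - x)" using m by (simp add: divide_le_eq)
            then show ?case by (simp add: cut_def)
          qed
        qed
        ultimately have hl: "(\<lambda>n. h n x) \<longlonglongrightarrow> u x"
          unfolding h_def using tendsto_mult by fastforce
        have "(\<lambda>n. h n x - T n x) \<longlonglongrightarrow> 0"
          by (rule Lim_null_comparison[OF _ LIMSEQ_inverse_real_of_nat])
             (use T(2)[OF x] less_imp_le in \<open>auto intro!: always_eventually\<close>)
        from tendsto_diff[OF hl this] show "(\<lambda>n. T n x) \<longlonglongrightarrow> u x" by simp
      qed
    qed
    then show ?thesis by (subst AE_restrict_space_iff) auto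
  qed
  ultimately show ?thesis using that T(1) by blast
qed

text \<open>Two dominated convergences: \<open>u\<close> is truncated to a bounded
  \<open>v K\<close>, which is then approximated boundedly and almost everywhere. Each error stays
  below \<open>e / 4\<close> because \<open>|x + y|^2 \<le> 2|x|^2 + 2|y|^2\<close> doubles
  both.\<close>

lemma trig_L2_approximation:
  fixes u :: "real \<Rightarrow> complex"
  assumes L: "L > 0" and u [measurable]: "u \<in> borel_measurable lborel"
    and u2: "integrable (period_measure L) (\<lambda>x. (norm (u x))\<^sup>2)" and e: "e > 0"
  obtains T where "T \<in> trig_polynomials L" "(LINT x|period_measure L. (norm (u x - T x))\<^sup>2) < e"
proof -
  let ?M = "period_measure L"
  interpret finite_measure ?M by (rule finite_measure_period)
  have uM [measurable]: "u \<in> borel_measurable ?M" by (rule measurable_restrict_space1) (rule u)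
  define v where "v K x = (if norm (u x) \<le> real K then u x else 0)" for K :: nat and x
  have v [measurable]: "v K \<in> borel_measurable lborel" for K
    unfolding v_def by measurable
  have vM [measurable]: "v K \<in> borel_measurable ?M" for K
    by (rule measurable_restrict_space1) (rule v)
  have "(\<lambda>K. LINT x|?M. (norm (u x - v K x))\<^sup>2) \<longlonglongrightarrow> (LINT x|?M. 0)"
  proof (rule integral_dominated_convergence[OF _ _ u2])
    show "AE x in ?M. (\<lambda>K. (norm (u x - v K x))\<^sup>2) \<longlonglongrightarrow> 0"
    proof (rule AE_I2, rule tendsto_eventually)
      fix x
      have "\<forall>\<^sub>F K in sequentially. norm (u x) \<le> real K"
        using filterlim_real_sequentially by (rule filterlim_at_top[THEN iffD1, rule_format])
      then show "\<forall>\<^sub>F K in sequentially. (norm (u x - v K x))\<^sup>2 = 0"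
        by eventually_elim (simp add: v_def)
    qed
  qed (auto simp: v_def)
  then have "\<forall>\<^sub>F K in sequentially. (LINT x|?M. (norm (u x - v K x))\<^sup>2) < e / 4"
    by (rule order_tendstoD) (use e in simp)
  then obtain K where K: "(LINT x|?M. (norm (u x - v K x))\<^sup>2) < e / 4"
    by (meson eventually_sequentially order_refl)
  have vK: "norm (v K x) \<le> real K" for x by (simp add: v_def)
  obtain T where T: "\<And>n. T n \<in> trig_polynomials L" "\<And>n x. x \<in> {0..<L} \<Longrightarrow> norm (T n x) \<le> real K + 1"
    "AE x in ?M. (\<lambda>n. T n x) \<longlonglongrightarrow> v K x"
    using bounded_trig_pointwise_approximation[OF L v vK] by blast
  have T_meas [measurable]: "T n \<in> borel_measurable ?M" for n
    using T(1)[of n] by (auto simp: trig_polynomials_def intro!: measurable_restrict_space1)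
  have "(\<lambda>n. LINT x|?M. (norm (v K x - T n x))\<^sup>2) \<longlonglongrightarrow> (LINT x|?M. 0)"
  proof (rule integral_dominated_convergence[where w = "\<lambda>x. (2 * real K + 1)\<^sup>2"])
    show "AE x in ?M. (\<lambda>n. (norm (v K x - T n x))\<^sup>2) \<longlonglongrightarrow> 0"
      using T(3)
    proof eventually_elim
      case (elim x)
      have "(\<lambda>n. (norm (v K x - T n x))\<^sup>2) \<longlonglongrightarrow> (norm (v K x - v K x))\<^sup>2"
        by (intro tendsto_intros elim)
      then show ?case by simp
    qed
    show "AE x in ?M. norm ((norm (v K x - T n x))\<^sup>2) \<le> (2 * real K + 1)\<^sup>2" for n
    proof (rule AE_I2)
      fix x assume "x \<in> space ?M"
      then have "norm (v K x - T n x) \<le> 2 * real K + 1"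
        using norm_triangle_ineq4[of "v K x" "T n x"] vK[of x] T(2)[of x n] by simp
      then show "norm ((norm (v K x - T n x))\<^sup>2) \<le> (2 * real K + 1)\<^sup>2"
        by (simp add: power_mono)
    qed
  qed auto
  then have "\<forall>\<^sub>F n in sequentially. (LINT x|?M. (norm (v K x - T n x))\<^sup>2) < e / 4"
    by (rule order_tendstoD) (use e in simp)
  then obtain n where n: "(LINT x|?M. (norm (v K x - T n x))\<^sup>2) < e / 4"
    by (meson eventually_sequentially order_refl)
  have i1: "integrable ?M (\<lambda>x. (norm (u x - v K x))\<^sup>2)"
    by (rule Bochner_Integration.integrable_bound[OF u2]) (auto simp: v_def)
  have i2: "integrable ?M (\<lambda>x. (norm (v K x - T n x))\<^sup>2)"
  proof (rule integrable_const_bound[where B = "(2 * real K + 1)\<^sup>2"])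
    show "AE x in ?M. norm ((norm (v K x - T n x))\<^sup>2) \<le> (2 * real K + 1)\<^sup>2"
    proof (rule AE_I2)
      fix x assume "x \<in> space ?M"
      then have "norm (v K x - T n x) \<le> 2 * real K + 1"
        using norm_triangle_ineq4[of "v K x" "T n x"] vK[of x] T(2)[of x n] by simp
      then show "norm ((norm (v K x - T n x))\<^sup>2) \<le> (2 * real K + 1)\<^sup>2"
        by (simp add: power_mono)
    qed
  qed auto
  have "(LINT x|?M. (norm (u x - T n x))\<^sup>2) < e"
    using integrable_norm_sq_add(2)[OF _ _ i1 i2] K n by simp
  with T(1) show ?thesis using that by blast
qed

text \<open>The frame definition speaks of unordered sums, whereas Tonelli, Fatou and monotonicity
  are at hand for nonnegative integrals. This equivalence is the passage between the two.\<close>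

lemma nn_integral_count_space_has_sum:
  fixes f :: "'a \<Rightarrow> real"
  assumes f: "\<And>x. x \<in> A \<Longrightarrow> f x \<ge> 0" and S: "S \<ge> 0"
  shows "(\<integral>\<^sup>+x. ennreal (f x) \<partial>count_space A) = ennreal S \<longleftrightarrow> (f has_sum S) A"
proof
  assume *: "(\<integral>\<^sup>+x. ennreal (f x) \<partial>count_space A) = ennreal S"
  have i: "integrable (count_space A) f"
  proof (rule integrableI_nonneg)
    show "AE x in count_space A. 0 \<le> f x" using f by (simp add: AE_count_space)
    show "(\<integral>\<^sup>+x. ennreal (f x) \<partial>count_space A) < \<infinity>" unfolding * by simp
  qed simp
  then have "f summable_on A"
    unfolding abs_summable_on_def[symmetric]
    by (rule abs_summable_equivalent[THEN iffD2, THEN abs_summable_summable])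
  moreover have "infsum f A = S"
  proof -
    have "infsum f A = (LINT x|count_space A. f x)"
      using infsetsum_infsum[of f A] i unfolding abs_summable_on_def infsetsum_def by simp
    also have "\<dots> = S"
      by (subst integral_eq_nn_integral) (use f S in \<open>simp_all add: AE_count_space *\<close>)
    finally show ?thesis .
  qed
  ultimately show "(f has_sum S) A" by (simp add: has_sum_iff)
next
  assume *: "(f has_sum S) A"
  then have "integrable (count_space A) f"
    unfolding abs_summable_on_def[symmetric]
    using f summable_on_cong[of A "\<lambda>x. norm (f x)" f]
    by (subst abs_summable_equivalent[symmetric]) (auto simp: has_sum_iff)
  then have i: "integrable (count_space A) f" .
  have "(LINT x|count_space A. f x) = S"
    using infsetsum_infsum[of f A] i * unfolding abs_summable_on_def infsetsum_def has_sum_iff by simp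
  then show "(\<integral>\<^sup>+x. ennreal (f x) \<partial>count_space A) = ennreal S"
    using f by (subst nn_integral_eq_integral[OF i]) (auto simp: AE_count_space)
qed

text \<open>Bessel bounds the partial sums. For the converse, a trigonometric polynomial close to
  \<open>u\<close> is inserted in the error identity and the nonnegative last term is dropped: the
  partial sum over the support of the polynomial already exceeds \<open>L * ?S - e\<close>.\<close>

theorem parseval_period:
  fixes u :: "real \<Rightarrow> complex"
  assumes L: "L > 0" and u [measurable]: "u \<in> borel_measurable lborel"
    and u2: "integrable (period_measure L) (\<lambda>x. (norm (u x))\<^sup>2)"
  shows "((\<lambda>n. (norm (fourier_coeff L u n))\<^sup>2) has_sum
           L * (LINT x|period_measure L. (norm (u x))\<^sup>2)) UNIV"
proof -
  let ?M = "period_measure L" and ?c = "fourier_coeff L u"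
  let ?S = "LINT x|?M. (norm (u x))\<^sup>2"
  have uM [measurable]: "u \<in> borel_measurable ?M" by (rule measurable_restrict_space1) (rule u)
  note err = trig_approximation_error[OF L _ uM u2]
  have bessel: "(\<Sum>n\<in>F. (norm (?c n))\<^sup>2) \<le> L * ?S" if "finite F" for F
  proof -
    have "0 \<le> (LINT x|?M. (norm (u x - (\<Sum>n\<in>F. (?c n / L) * harmonic L n x)))\<^sup>2)"
      by (rule Bochner_Integration.integral_nonneg) simp
    then have "0 \<le> ?S - (\<Sum>n\<in>F. (norm (?c n))\<^sup>2) / L"
      unfolding err[OF that] by simp
    then show ?thesis using L by (simp add: field_simps)
  qed
  have appr: "\<exists>F. finite F \<and> L * ?S - e < (\<Sum>n\<in>F. (norm (?c n))\<^sup>2)" if "e > 0" for e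
  proof -
    from that L have "e / L > 0" by simp
    from trig_L2_approximation[OF L u u2 this]
    obtain T where T: "T \<in> trig_polynomials L" "(LINT x|?M. (norm (u x - T x))\<^sup>2) < e / L"
      by metis
    then obtain F d where F: "finite F" "T = (\<lambda>x. \<Sum>n\<in>F. d n * harmonic L n x)"
      by (auto simp: trig_polynomials_def)
    have "0 \<le> L * (\<Sum>n\<in>F. (norm (d n - ?c n / L))\<^sup>2)"
      using L by (simp add: sum_nonneg)
    then have "?S - (\<Sum>n\<in>F. (norm (?c n))\<^sup>2) / L < e / L"
      using T(2) err[OF F(1), of d] unfolding F(2) by linarith
    then have "L * (?S - (\<Sum>n\<in>F. (norm (?c n))\<^sup>2) / L) < L * (e / L)"
      using L by (rule mult_strict_left_mono)
    then show ?thesis using L F(1) by (intro exI[of _ F]) (auto simp: right_diff_distrib)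
  qed
  have summ: "(\<lambda>n. (norm (?c n))\<^sup>2) summable_on UNIV"
    by (rule nonneg_bdd_above_summable_on) (use bessel in \<open>auto intro!: bdd_aboveI\<close>)
  have "infsum (\<lambda>n. (norm (?c n))\<^sup>2) UNIV \<le> L * ?S"
    by (rule infsum_le_finite_sums[OF summ bessel])
  moreover have "L * ?S \<le> infsum (\<lambda>n. (norm (?c n))\<^sup>2) UNIV"
  proof (rule field_le_epsilon)
    fix e :: real assume "e > 0"
    then obtain F where F: "finite F" "L * ?S - e < (\<Sum>n\<in>F. (norm (?c n))\<^sup>2)" using appr by blast
    have "(\<Sum>n\<in>F. (norm (?c n))\<^sup>2) \<le> infsum (\<lambda>n. (norm (?c n))\<^sup>2) UNIV"
      by (rule finite_sum_le_infsum[OF summ F(1)]) auto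
    then show "L * ?S \<le> infsum (\<lambda>n. (norm (?c n))\<^sup>2) UNIV + e" using F by linarith
  qed
  ultimately show ?thesis using summ by (simp add: has_sum_iff)
qed

section \<open>Fiber bounds for finite sequences\<close>

lemma continuous_has_antiderivative:
  fixes f :: "real \<Rightarrow> real"
  assumes "continuous_on UNIV f"
  obtains F where "\<And>x. (F has_real_derivative f x) (at x)"
proof -
  have "\<exists>F. \<forall>x::real. -\<infinity> < ereal x \<longrightarrow> ereal x < \<infinity> \<longrightarrow> (F has_vector_derivative f x) (at x)"
    by (rule einterval_antiderivative)
       (use assms in \<open>auto simp: continuous_on_eq_continuous_at\<close>)
  then show ?thesis using that by (auto simp: has_real_derivative_iff_has_vector_derivative)
qed

lemma integral_antiderivative:
  fixes F f :: "real \<Rightarrow> real"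
  assumes "\<And>x. (F has_real_derivative f x) (at x)" "a \<le> b"
  shows "integral {a..b} (\<lambda>x. f (x + c)) = F (b + c) - F (a + c)"
proof -
  have "((\<lambda>x. f (x + c)) has_integral F (b + c) - F (a + c)) {a..b}"
  proof (rule fundamental_theorem_of_calculus[OF assms(2)])
    fix x
    have "((\<lambda>x. F (x + c)) has_real_derivative f (x + c) * 1) (at x)"
      by (rule DERIV_chain2[OF assms(1)]) (auto intro!: derivative_eq_intros)
    then show "((\<lambda>x. F (x + c)) has_vector_derivative f (x + c)) (at x within {a..b})"
      by (simp add: has_real_derivative_iff_has_vector_derivative has_vector_derivative_at_within)
  qed
  then show ?thesis by (rule integral_unique)
qed

text \<open>For an antiderivative \<open>F\<close>, periodicity says that
  \<open>F (x + P) - F x\<close> is constant and nonnegativity makes \<open>F\<close> monotone, so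
  the integral up to \<open>b\<close> is at most \<open>n\<close> full periods.\<close>

lemma integral_periodic_le:
  fixes p :: "real \<Rightarrow> real"
  assumes p: "continuous_on UNIV p" "\<And>x. p x \<ge> 0" "\<And>x. p (x + P) = p x"
    and P: "P > 0" and n: "b \<le> real n * P" and b: "b \<ge> 0"
  shows "integral {0..b} p \<le> real n * integral {0..P} p"
proof -
  obtain F where F: "\<And>x. (F has_real_derivative p x) (at x)"
    using continuous_has_antiderivative[OF p(1)] by blast
  note I = integral_antiderivative[OF F, where c = 0, simplified]
  have F': "((\<lambda>x. F (x + P)) has_real_derivative p (x + P)) (at x)" for x
    using F[of "x + P"] by (simp add: DERIV_shift)
  have "((\<lambda>x. F (x + P) - F x) has_real_derivative 0) (at x)" for x
    using DERIV_diff[OF F'[of x] F[of x]] p(3)[of x] by simp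
  then have const: "F (x + P) - F x = F P - F 0" for x
    using DERIV_isconst_all[of "\<lambda>x. F (x + P) - F x" x 0] by auto
  have "F (real n * P) - F 0 = real n * (F P - F 0)"
  proof (induction n)
    case (Suc n)
    then show ?case using const[of "real n * P"] by (simp add: algebra_simps)
  qed simp
  moreover have "F b \<le> F (real n * P)"
    using n by (rule DERIV_nonneg_imp_nondecreasing) (use F p(2) in blast)
  ultimately show ?thesis using I[OF b] I[of 0 P] P by simp
qed

text \<open>After substitution the left side is \<open>exp (s * c)\<close> times the integral of
  \<open>exp (- s * x) * p x\<close> over the window from \<open>c\<close> to \<open>c + P\<close>.
  Sliding the window to the right can only decrease it: the derivative in \<open>c\<close> is the
  integrand at \<open>c + P\<close> minus that at \<open>c\<close>, where \<open>p\<close> agrees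
  and the exponential has dropped.\<close>

lemma integral_exp_periodic_shift_le:
  fixes p :: "real \<Rightarrow> real"
  assumes p: "continuous_on UNIV p" "\<And>x. p x \<ge> 0" "\<And>x. p (x + P) = p x"
    and P: "P > 0" and s: "s > 0" and c: "c \<ge> 0"
  shows "integral {0..P} (\<lambda>x. exp (- s * x) * p (x + c)) \<le> exp (s * c) * integral {0..P} (\<lambda>x. exp (- s * x) * p x)"
proof -
  let ?f = "\<lambda>x. exp (- s * x) * p x"
  have "continuous_on UNIV ?f" by (intro continuous_intros p)
  from continuous_has_antiderivative[OF this]
  obtain F where F: "\<And>x. (F has_real_derivative ?f x) (at x)" by blast
  have F': "((\<lambda>x. F (x + P)) has_real_derivative ?f (x + P)) (at x)" for x
    using F[of "x + P"] by (simp add: DERIV_shift)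
  have "F (c + P) - F c \<le> F (0 + P) - F 0"
  proof (rule DERIV_nonpos_imp_nonincreasing[OF c])
    fix x :: real
    have "?f (x + P) - ?f x \<le> 0"
      using P s p(2)[of x] p(3)[of x] by (simp add: mult_right_mono)
    then show "\<exists>y. ((\<lambda>x. F (x + P) - F x) has_real_derivative y) (at x) \<and> y \<le> 0"
      using DERIV_diff[OF F'[of x] F[of x]] by blast
  qed
  then have "integral {0..P} (\<lambda>x. ?f (x + c)) \<le> integral {0..P} (\<lambda>x. ?f (x + 0))"
    using P by (subst (1 2) integral_antiderivative[OF F]) (auto simp: add_ac)
  then have "exp (s * c) * integral {0..P} (\<lambda>x. ?f (x + c)) \<le> exp (s * c) * integral {0..P} (\<lambda>x. ?f (x + 0))"
    by (rule mult_left_mono) simp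
  moreover have "exp (s * c) * integral {0..P} (\<lambda>x. ?f (x + c)) = integral {0..P} (\<lambda>x. exp (- s * x) * p (x + c))"
  proof -
    have eq: "exp (s * c) * ?f (x + c) = exp (- s * x) * p (x + c)" for x
      by (simp add: mult.assoc[symmetric] exp_add[symmetric] ring_distribs)
    show ?thesis
      by (subst integral_mult_right[symmetric], rule integral_cong, rule eq)
  qed
  ultimately show ?thesis by (simp only: add_0_right)
qed

text \<open>The nodes differ by multiples of \<open>L\<close>, so apart from a common phase the sum
  is a trigonometric polynomial of period \<open>1/L\<close>; reflecting the index absorbs the minus
  sign. Its norm is the error identity with \<open>u = 0\<close>.\<close>

lemma integral_norm_sq_exponential_sum:
  assumes J: "finite J" and L: "L > 0"
  shows "integral {0..1/L} (\<lambda>\<xi>. (norm (\<Sum>j\<in>J. d j * cis (- 2 * pi * (t + of_int j * L) * \<xi>)))\<^sup>2)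
     = (\<Sum>j\<in>J. (norm (d j))\<^sup>2) / L"
proof -
  let ?T = "\<lambda>\<xi>. \<Sum>n\<in>uminus ` J. d (- n) * harmonic (1/L) n \<xi>"
  have "(\<Sum>j\<in>J. d j * cis (- 2 * pi * (t + of_int j * L) * \<xi>)) = cis (- 2 * pi * t * \<xi>) * ?T \<xi>" for \<xi>
    by (subst sum.reindex)
       (auto simp: harmonic_def sum_distrib_left cis_mult algebra_simps intro!: sum.cong arg_cong[where f = cis])
  then have "(norm (\<Sum>j\<in>J. d j * cis (- 2 * pi * (t + of_int j * L) * \<xi>)))\<^sup>2 = (norm (?T \<xi>))\<^sup>2" for \<xi>
    by (simp add: norm_mult)
  moreover have "integral {0..1/L} (\<lambda>\<xi>. (norm (?T \<xi>))\<^sup>2) = (\<Sum>n\<in>uminus ` J. (norm (d (- n)))\<^sup>2) / L"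
  proof -
    have "integral {0..1/L} (\<lambda>\<xi>. (norm (?T \<xi>))\<^sup>2) = (LINT \<xi>|period_measure (1/L). (norm (?T \<xi>))\<^sup>2)"
      by (rule period_integral_continuous(2)[symmetric]) (intro continuous_intros)
    also have "\<dots> = (LINT \<xi>|period_measure (1/L). (norm (0 - ?T \<xi>))\<^sup>2)" by simp
    also have "\<dots> = (\<Sum>n\<in>uminus ` J. (norm (d (- n)))\<^sup>2) / L"
      by (subst trig_approximation_error) (use J L in \<open>auto simp: fourier_coeff_def\<close>)
    finally show ?thesis .
  qed
  ultimately show ?thesis by (simp add: sum.reindex)
qed

section \<open>Exponential sums attached to the poles\<close>

locale herglotz_window =
  fixes N :: nat and a w :: "nat \<Rightarrow> real" and g :: "real \<Rightarrow> complex" and \<alpha> L :: real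
  assumes N: "N \<ge> 1"
    and a: "\<And>k. k \<in> {1..N} \<Longrightarrow> a k > 0"
    and w: "\<And>k. k \<in> {1..N} \<Longrightarrow> w k > 0"
    and g: "\<And>t. g t = (\<Sum>k=1..N. of_real (a k) / (of_real t - \<i> * of_real (w k)))"
    and \<alpha>: "\<alpha> > 0" and L: "L > 0"
begin

definition decay :: "nat \<Rightarrow> real" where
  "decay k = exp (- 2 * pi * w k / \<alpha>)"

definition freq :: "real \<Rightarrow> int \<Rightarrow> real" where
  "freq t j = - 2 * pi * (t + of_int j * L)"

definition exp_sum :: "real \<Rightarrow> (int \<Rightarrow> complex) \<Rightarrow> int set \<Rightarrow> real \<Rightarrow> complex" where
  "exp_sum t c J \<xi> = (\<Sum>j\<in>J. c j * cis (freq t j * \<xi>))"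

text \<open>Closed form of the geometric series with terms
  \<open>decay k ^ l * exp_sum t c J (\<xi> + l/\<alpha>)\<close>: each shift by
  \<open>1/\<alpha>\<close> multiplies the \<open>j\<close>-th exponential by
  \<open>cis (freq t j / \<alpha>)\<close>. Being again an \<open>exp_sum\<close>, it inherits the
  periodic modulus and the norm formula.\<close>

definition pole_sum :: "real \<Rightarrow> (int \<Rightarrow> complex) \<Rightarrow> int set \<Rightarrow> nat \<Rightarrow> real \<Rightarrow> complex" where
  "pole_sum t c J k = exp_sum t (\<lambda>j. c j / (1 - of_real (decay k) * cis (freq t j / \<alpha>))) J"

definition symbol :: "real \<Rightarrow> (int \<Rightarrow> complex) \<Rightarrow> int set \<Rightarrow> real \<Rightarrow> complex" where
  "symbol t c J \<xi> = (\<Sum>k=1..N. of_real (a k * exp (- 2 * pi * w k * \<xi>)) * pole_sum t c J k \<xi>)"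

lemma decay: "k \<in> {1..N} \<Longrightarrow> 0 < decay k \<and> decay k < 1"
  using w[of k] \<alpha> by (simp add: decay_def)

lemma denominator_bounds:
  assumes "k \<in> {1..N}"
  shows "1 - decay k \<le> norm (1 - of_real (decay k) * cis x)" "norm (1 - of_real (decay k) * cis x) \<le> 2"
proof -
  have "norm (of_real (decay k) * cis x) = decay k"
    using decay[OF assms] by (simp add: norm_mult)
  then show "1 - decay k \<le> norm (1 - of_real (decay k) * cis x)" "norm (1 - of_real (decay k) * cis x) \<le> 2"
    using norm_triangle_ineq2[of 1 "of_real (decay k) * cis x"]
      norm_triangle_ineq4[of 1 "of_real (decay k) * cis x"] decay[OF assms] by auto
qed

lemma denominator_nonzero:
  "k \<in> {1..N} \<Longrightarrow> 1 - of_real (decay k) * cis x \<noteq> 0"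
  using denominator_bounds(1)[of k x] decay[of k] by auto

lemma continuous_exp_sum [continuous_intros]: "continuous_on S (exp_sum t c J)"
  unfolding exp_sum_def[abs_def] cis_conv_exp by (intro continuous_intros)

lemma continuous_pole_sum [continuous_intros]: "continuous_on S (pole_sum t c J k)"
  unfolding pole_sum_def by (intro continuous_intros)

lemma continuous_symbol [continuous_intros]: "continuous_on S (symbol t c J)"
  unfolding symbol_def[abs_def] by (intro continuous_intros)

text \<open>Shifting by \<open>1/L\<close> multiplies every term by the same phase
  \<open>cis (- 2 * pi * t / L)\<close>, because \<open>j\<close> contributes only full turns. The
  sum itself is in general not periodic.\<close>

lemma norm_exp_sum_periodic: "norm (exp_sum t c J (\<xi> + 1/L)) = norm (exp_sum t c J \<xi>)"
proof -
  have "cis (freq t j * (\<xi> + 1/L)) = cis (- 2 * pi * t / L) * cis (freq t j * \<xi>)" for j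
  proof -
    have "freq t j * (\<xi> + 1/L) = (- 2 * pi * t / L) + freq t j * \<xi> + 2 * pi * of_int (- j)"
      using L by (simp add: freq_def field_simps)
    then have "cis (freq t j * (\<xi> + 1/L)) = cis (- 2 * pi * t / L) * cis (freq t j * \<xi>) * cis (2 * pi * of_int (- j))"
      by (simp only: cis_mult)
    moreover have "cis (2 * pi * of_int (- j)) = 1"
      by (rule cis_multiple_2pi) auto
    ultimately show ?thesis by simp
  qed
  then have "exp_sum t c J (\<xi> + 1/L) = cis (- 2 * pi * t / L) * exp_sum t c J \<xi>"
    by (simp add: exp_sum_def sum_distrib_left mult_ac)
  then show ?thesis by (simp add: norm_mult)
qed

lemma integral_exp_sum:
  "finite J \<Longrightarrow> integral {0..1/L} (\<lambda>\<xi>. (norm (exp_sum t c J \<xi>))\<^sup>2) = (\<Sum>j\<in>J. (norm (c j))\<^sup>2) / L"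
  unfolding exp_sum_def freq_def using integral_norm_sq_exponential_sum[OF _ L] by simp

text \<open>The coefficients of \<open>pole_sum\<close> are the \<open>c j\<close> divided by
  numbers of modulus between \<open>1 - decay k\<close> and 2, and the squared norm of an
  exponential sum over one period is explicit. The bounds see neither \<open>t\<close> nor
  \<open>J\<close>.\<close>

lemma integral_pole_sum_bounds:
  assumes J: "finite J" and k: "k \<in> {1..N}"
  shows "(\<Sum>j\<in>J. (norm (c j))\<^sup>2) / (4 * L) \<le> integral {0..1/L} (\<lambda>\<xi>. (norm (pole_sum t c J k \<xi>))\<^sup>2)"
    and "integral {0..1/L} (\<lambda>\<xi>. (norm (pole_sum t c J k \<xi>))\<^sup>2) \<le> (\<Sum>j\<in>J. (norm (c j))\<^sup>2) / (L * (1 - decay k)\<^sup>2)"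
proof -
  let ?d = "\<lambda>j. 1 - of_real (decay k) * cis (freq t j / \<alpha>)"
  have I: "integral {0..1/L} (\<lambda>\<xi>. (norm (pole_sum t c J k \<xi>))\<^sup>2) = (\<Sum>j\<in>J. (norm (c j / ?d j))\<^sup>2) / L"
    unfolding pole_sum_def by (rule integral_exp_sum[OF J])
  have "(norm (c j))\<^sup>2 / 4 \<le> (norm (c j / ?d j))\<^sup>2" for j
  proof -
    have "(norm (?d j))\<^sup>2 \<le> 2\<^sup>2"
      using denominator_bounds[OF k] by (intro power_mono) auto
    then have "(norm (c j))\<^sup>2 / 4 \<le> (norm (c j))\<^sup>2 / (norm (?d j))\<^sup>2"
      using denominator_nonzero[OF k] by (intro divide_left_mono) (auto simp: zero_less_mult_iff)
    then show ?thesis by (simp add: norm_divide power_divide)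
  qed
  then have "(\<Sum>j\<in>J. (norm (c j))\<^sup>2 / 4) \<le> (\<Sum>j\<in>J. (norm (c j / ?d j))\<^sup>2)"
    by (rule sum_mono)
  then show "(\<Sum>j\<in>J. (norm (c j))\<^sup>2) / (4 * L) \<le> integral {0..1/L} (\<lambda>\<xi>. (norm (pole_sum t c J k \<xi>))\<^sup>2)"
    unfolding I using L by (simp add: field_simps flip: sum_divide_distrib)
  have "(norm (c j / ?d j))\<^sup>2 \<le> (norm (c j))\<^sup>2 / (1 - decay k)\<^sup>2" for j
  proof -
    have "(1 - decay k)\<^sup>2 \<le> (norm (?d j))\<^sup>2"
      using denominator_bounds[OF k] decay[OF k] by (intro power_mono) auto
    then have "(norm (c j))\<^sup>2 / (norm (?d j))\<^sup>2 \<le> (norm (c j))\<^sup>2 / (1 - decay k)\<^sup>2"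
      using denominator_nonzero[OF k] decay[OF k] by (intro divide_left_mono) (auto simp: zero_less_mult_iff)
    then show ?thesis by (simp add: norm_divide power_divide)
  qed
  then have "(\<Sum>j\<in>J. (norm (c j / ?d j))\<^sup>2) \<le> (\<Sum>j\<in>J. (norm (c j))\<^sup>2) / (1 - decay k)\<^sup>2"
    unfolding sum_divide_distrib by (rule sum_mono)
  from divide_right_mono[OF this, of L]
  show "integral {0..1/L} (\<lambda>\<xi>. (norm (pole_sum t c J k \<xi>))\<^sup>2) \<le> (\<Sum>j\<in>J. (norm (c j))\<^sup>2) / (L * (1 - decay k)\<^sup>2)"
    unfolding I using L by (simp add: mult.commute)
qed

lemma exp_sum_pole_sum:
  assumes k: "k \<in> {1..N}"
  shows "exp_sum t c J \<xi> = pole_sum t c J k \<xi> - of_real (decay k) * pole_sum t c J k (\<xi> + 1/\<alpha>)"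
proof -
  have "c j * cis (freq t j * \<xi>) =
    c j / (1 - of_real (decay k) * cis (freq t j / \<alpha>)) * cis (freq t j * \<xi>) -
     of_real (decay k) * (c j / (1 - of_real (decay k) * cis (freq t j / \<alpha>)) * cis (freq t j * (\<xi> + 1/\<alpha>)))" for j
  proof -
    define d where "d = 1 - of_real (decay k) * cis (freq t j / \<alpha>)"
    have "cis (freq t j * (\<xi> + 1/\<alpha>)) = cis (freq t j * \<xi>) * cis (freq t j / \<alpha>)"
      by (simp add: cis_mult ring_distribs)
    then have "c j / d * cis (freq t j * \<xi>) - of_real (decay k) * (c j / d * cis (freq t j * (\<xi> + 1/\<alpha>)))
       = c j / d * cis (freq t j * \<xi>) * (1 - of_real (decay k) * cis (freq t j / \<alpha>))"
      by (simp add: right_diff_distrib)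
    also have "\<dots> = c j * cis (freq t j * \<xi>)"
      using denominator_nonzero[OF k, of "freq t j / \<alpha>"] unfolding d_def by simp
    finally show ?thesis unfolding d_def by (rule sym)
  qed
  then show ?thesis
    by (simp add: exp_sum_def pole_sum_def sum_distrib_left flip: sum_subtractf)
qed

definition fiber_value :: "real \<Rightarrow> (int \<Rightarrow> complex) \<Rightarrow> int set \<Rightarrow> int \<Rightarrow> complex" where
  "fiber_value t c J m = (\<Sum>j\<in>J. c j * g (t + of_int j * L - \<alpha> * of_int m))"

text \<open>
  The factor \<open>1 - decay k * cis (freq t j / \<alpha>)\<close> in \<open>pole_sum\<close> cancels the boundary term of the
  integral of an exponential over \<open>[0, 1/\<alpha>]\<close>.
\<close>

lemma fourier_coeff_symbol:
  "fourier_coeff (1/\<alpha>) (symbol t c J) (- m) = fiber_value t c J m / (2 * of_real pi * \<i>)"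
proof -
  let ?\<sigma> = "\<lambda>j k. 2 * of_real (pi * w k) - \<i> * of_real (freq t j) :: complex"
  let ?z = "\<lambda>j k. 2 * of_real pi * \<i> * (of_real (t + of_int j * L - \<alpha> * of_int m) - \<i> * of_real (w k)) :: complex"
  have z: "?z j k = ?\<sigma> j k - 2 * of_real (pi * \<alpha> * of_int m) * \<i>" for j k
    by (simp add: freq_def algebra_simps)
  have z0: "?z j k \<noteq> 0" if "k \<in> {1..N}" for j k
    using w[OF that] by (auto simp: complex_eq_iff)
  have term1: "of_real (a k * exp (- 2 * pi * w k * \<xi>)) * (c j / (1 - of_real (decay k) * cis (freq t j / \<alpha>)) * cis (freq t j * \<xi>))
     * cnj (harmonic (1/\<alpha>) (- m) \<xi>) = a k * c j / (1 - of_real (decay k) * cis (freq t j / \<alpha>)) * exp (- ?z j k * of_real \<xi>)" for j k \<xi>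
  proof -
    have "of_real (exp (- 2 * pi * w k * \<xi>)) * cis (freq t j * \<xi>) * cnj (harmonic (1/\<alpha>) (- m) \<xi>) = exp (- ?z j k * of_real \<xi>)"
      unfolding z harmonic_def cis_cnj
      unfolding cis_conv_exp exp_of_real[symmetric] exp_add[symmetric]
      by (rule arg_cong[where f = exp]) (simp add: algebra_simps)
    then show ?thesis by (simp add: mult_ac)
  qed
  have "integral {0..1/\<alpha>} (\<lambda>\<xi>. symbol t c J \<xi> * cnj (harmonic (1/\<alpha>) (- m) \<xi>))
    = integral {0..1/\<alpha>} (\<lambda>\<xi>. \<Sum>k=1..N. \<Sum>j\<in>J. a k * c j / (1 - of_real (decay k) * cis (freq t j / \<alpha>)) * exp (- ?z j k * of_real \<xi>))"
    unfolding symbol_def pole_sum_def exp_sum_def sum_distrib_left sum_distrib_right term1 ..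
  also have "\<dots> = (\<Sum>k=1..N. \<Sum>j\<in>J. integral {0..1/\<alpha>} (\<lambda>\<xi>. a k * c j / (1 - of_real (decay k) * cis (freq t j / \<alpha>)) * exp (- ?z j k * of_real \<xi>)))"
  proof (cases "finite J")
    case True
    define A where "A k j = a k * c j / (1 - of_real (decay k) * cis (freq t j / \<alpha>))" for k j
    show ?thesis
      unfolding A_def[symmetric] using True
      by (subst integral_sum; (subst integral_sum)?;
          auto intro!: integrable_continuous_interval continuous_intros integrable_sum)
  qed simp
  also have "\<dots> = (\<Sum>k=1..N. \<Sum>j\<in>J. a k * c j / ?z j k)"
  proof (intro sum.cong refl)
    fix k j assume k: "k \<in> {1..N}"
    have "integral {0..1/\<alpha>} (\<lambda>\<xi>. exp (- ?z j k * of_real \<xi>)) = (exp (- ?z j k * of_real (1/\<alpha>)) - 1) / (- ?z j k)"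
      using integral_exp_linear[of "- ?z j k" 0 "1/\<alpha>"] z0[OF k, of j] \<alpha> by simp
    moreover have "exp (- ?z j k * of_real (1/\<alpha>)) = of_real (decay k) * cis (freq t j / \<alpha>)"
    proof -
      have "- ?z j k * of_real (1/\<alpha>) = of_real (- 2 * pi * w k / \<alpha>) + \<i> * of_real (freq t j / \<alpha>) + 2 * of_int m * of_real pi * \<i>"
        unfolding z using \<alpha> by (simp add: field_simps)
      moreover have "exp (2 * of_int m * of_real pi * \<i>) = (1::complex)"
        using exp_integer_2pi[of "of_int m"] by simp
      ultimately show ?thesis
        by (simp only: exp_add exp_of_real decay_def cis_conv_exp) simp
    qed
    ultimately have "integral {0..1/\<alpha>} (\<lambda>\<xi>. exp (- ?z j k * of_real \<xi>)) = (1 - of_real (decay k) * cis (freq t j / \<alpha>)) / ?z j k"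
      by (simp add: minus_divide_left[symmetric] minus_divide_right[symmetric] diff_divide_distrib)
    then show "integral {0..1/\<alpha>} (\<lambda>\<xi>. a k * c j / (1 - of_real (decay k) * cis (freq t j / \<alpha>)) * exp (- ?z j k * of_real \<xi>)) = a k * c j / ?z j k"
      using denominator_nonzero[OF k, of "freq t j / \<alpha>"] by simp
  qed
  also have "\<dots> = (\<Sum>j\<in>J. \<Sum>k=1..N. a k * c j / ?z j k)"
    by (rule sum.swap)
  also have "\<dots> = fiber_value t c J m / (2 * of_real pi * \<i>)"
    unfolding fiber_value_def g sum_divide_distrib sum_distrib_left
    by (intro sum.cong refl) (simp add: mult_ac)
  finally show ?thesis
    unfolding fourier_coeff_def
    by (subst period_integral_continuous) (auto intro!: continuous_intros)
qed

text \<open>Parseval on \<open>[0, 1/\<alpha>]\<close> with the index reflected;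
  \<open>4 * pi\<^sup>2\<close> is the squared modulus of \<open>2 * pi * \<i>\<close>.\<close>

lemma fiber_value_has_sum:
  "((\<lambda>m. (norm (fiber_value t c J m))\<^sup>2) has_sum
     4 * pi\<^sup>2 / \<alpha> * integral {0..1/\<alpha>} (\<lambda>\<xi>. (norm (symbol t c J \<xi>))\<^sup>2)) UNIV"
proof -
  let ?f = "fourier_coeff (1/\<alpha>) (symbol t c J)"
  have c: "continuous_on {0..1/\<alpha>} (\<lambda>\<xi>. (norm (symbol t c J \<xi>))\<^sup>2)"
    by (intro continuous_intros)
  have "symbol t c J \<in> borel_measurable lborel"
    using borel_measurable_continuous_onI[OF continuous_symbol[of UNIV]] by simp
  then have "((\<lambda>n. (norm (?f n))\<^sup>2) has_sum 1 / \<alpha> * integral {0..1/\<alpha>} (\<lambda>\<xi>. (norm (symbol t c J \<xi>))\<^sup>2)) UNIV"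
    using parseval_period[of "1/\<alpha>" "symbol t c J"] \<alpha> period_integral_continuous[OF c] by simp
  then have "((\<lambda>n. (norm (?f n))\<^sup>2) has_sum 1 / \<alpha> * integral {0..1/\<alpha>} (\<lambda>\<xi>. (norm (symbol t c J \<xi>))\<^sup>2)) (range uminus)"
    by (simp add: surj_def)
  then have "((\<lambda>n. (norm (?f (- n)))\<^sup>2) has_sum 1 / \<alpha> * integral {0..1/\<alpha>} (\<lambda>\<xi>. (norm (symbol t c J \<xi>))\<^sup>2)) UNIV"
    by (subst (asm) has_sum_reindex) (auto simp: o_def)
  from has_sum_cmult_right[OF this, of "4 * pi\<^sup>2"]
  show ?thesis
    unfolding fourier_coeff_symbol by (simp add: norm_divide norm_mult power_divide power_mult_distrib)
qed

section \<open>Upper and lower bounds for the symbol\<close>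

definition upper_const :: real where
  "upper_const = 4 * pi\<^sup>2 / \<alpha> * ((\<Sum>k=1..N. (a k)\<^sup>2) *
     (\<Sum>k=1..N. real (nat \<lceil>L / \<alpha>\<rceil>) / (L * (1 - decay k)\<^sup>2)))"

text \<open>The exponential weights are at most 1 for \<open>\<xi> \<ge> 0\<close>, and
  Cauchy-Schwarz separates the poles. Covering \<open>[0, 1/\<alpha>]\<close> by
  \<open>nat \<lceil>L / \<alpha>\<rceil>\<close> periods of length \<open>1/L\<close> reduces the
  rest to one period. The argument is the same on both sides of the critical density.\<close>

lemma symbol_upper:
  assumes J: "finite J"
  shows "4 * pi\<^sup>2 / \<alpha> * integral {0..1/\<alpha>} (\<lambda>\<xi>. (norm (symbol t c J \<xi>))\<^sup>2)
     \<le> upper_const * (\<Sum>j\<in>J. (norm (c j))\<^sup>2)"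
proof -
  let ?n = "nat \<lceil>L / \<alpha>\<rceil>" and ?S = "\<Sum>j\<in>J. (norm (c j))\<^sup>2"
  have "L / \<alpha> \<le> real ?n" by (simp add: of_nat_ceiling)
  then have n: "1 / \<alpha> \<le> real ?n * (1 / L)" using L \<alpha> by (simp add: field_simps)
  have pt: "(norm (symbol t c J \<xi>))\<^sup>2 \<le> (\<Sum>k=1..N. (a k)\<^sup>2) * (\<Sum>k=1..N. (norm (pole_sum t c J k \<xi>))\<^sup>2)"
    if \<xi>: "\<xi> \<in> {0..1/\<alpha>}" for \<xi>
  proof -
    have "norm (symbol t c J \<xi>) \<le> (\<Sum>k=1..N. a k * norm (pole_sum t c J k \<xi>))"
      unfolding symbol_def
    proof (rule sum_norm_le)
      fix k assume k: "k \<in> {1..N}"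
      have "exp (- 2 * pi * w k * \<xi>) \<le> 1" using \<xi> w[OF k] by simp
      then have "a k * exp (- 2 * pi * w k * \<xi>) \<le> a k" using a[OF k] by simp
      then show "norm (of_real (a k * exp (- 2 * pi * w k * \<xi>)) * pole_sum t c J k \<xi>) \<le> a k * norm (pole_sum t c J k \<xi>)"
        using a[OF k] by (simp add: norm_mult mult_right_mono)
    qed
    then have "(norm (symbol t c J \<xi>))\<^sup>2 \<le> (\<Sum>k=1..N. a k * norm (pole_sum t c J k \<xi>))\<^sup>2"
      by (rule power_mono) simp
    also have "\<dots> \<le> (\<Sum>k=1..N. (a k)\<^sup>2) * (\<Sum>k=1..N. (norm (pole_sum t c J k \<xi>))\<^sup>2)"
      by (rule Cauchy_Schwarz_ineq_sum)
    finally show ?thesis .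
  qed
  have "integral {0..1/\<alpha>} (\<lambda>\<xi>. (norm (symbol t c J \<xi>))\<^sup>2)
     \<le> integral {0..1/\<alpha>} (\<lambda>\<xi>. (\<Sum>k=1..N. (a k)\<^sup>2) * (\<Sum>k=1..N. (norm (pole_sum t c J k \<xi>))\<^sup>2))"
    by (rule integral_le)
       (auto intro!: integrable_continuous_interval continuous_intros pt simp del: One_nat_def)
  also have "\<dots> = (\<Sum>k=1..N. (a k)\<^sup>2) * (\<Sum>k=1..N. integral {0..1/\<alpha>} (\<lambda>\<xi>. (norm (pole_sum t c J k \<xi>))\<^sup>2))"
    by (simp, subst integral_sum) (auto intro!: integrable_continuous_interval continuous_intros)
  also have "\<dots> \<le> (\<Sum>k=1..N. (a k)\<^sup>2) * (\<Sum>k=1..N. real ?n * (?S / (L * (1 - decay k)\<^sup>2)))"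
  proof (intro mult_left_mono sum_mono)
    fix k assume k: "k \<in> {1..N}"
    have "integral {0..1/\<alpha>} (\<lambda>\<xi>. (norm (pole_sum t c J k \<xi>))\<^sup>2) \<le> real ?n * integral {0..1/L} (\<lambda>\<xi>. (norm (pole_sum t c J k \<xi>))\<^sup>2)"
      by (rule integral_periodic_le[OF _ _ _ _ n])
         (use L \<alpha> norm_exp_sum_periodic in \<open>auto intro!: continuous_intros simp: pole_sum_def\<close>)
    also have "\<dots> \<le> real ?n * (?S / (L * (1 - decay k)\<^sup>2))"
      by (intro mult_left_mono integral_pole_sum_bounds[OF J k]) auto
    finally show "integral {0..1/\<alpha>} (\<lambda>\<xi>. (norm (pole_sum t c J k \<xi>))\<^sup>2) \<le> real ?n * (?S / (L * (1 - decay k)\<^sup>2))" .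
  qed (auto intro: sum_nonneg)
  also have "\<dots> = (\<Sum>k=1..N. (a k)\<^sup>2) * (\<Sum>k=1..N. real ?n / (L * (1 - decay k)\<^sup>2)) * ?S"
    by (simp add: sum_distrib_right mult.assoc)
  finally have "4 * pi\<^sup>2 / \<alpha> * integral {0..1/\<alpha>} (\<lambda>\<xi>. (norm (symbol t c J \<xi>))\<^sup>2) \<le>
     4 * pi\<^sup>2 / \<alpha> * ((\<Sum>k=1..N. (a k)\<^sup>2) * (\<Sum>k=1..N. real ?n / (L * (1 - decay k)\<^sup>2)) * ?S)"
    using \<alpha> by (intro mult_left_mono) auto
  then show ?thesis unfolding upper_const_def by (simp only: mult.assoc)
qed

text \<open>What survives of each pole in the test: 1/2 from halving the identity for
  \<open>2 Re\<close>, 1/4 from the lower bound on \<open>pole_sum\<close>,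
  \<open>1 - decay k\<close> after paying for the shifted term, and the smallest value of the weight
  on \<open>[0, 1/L]\<close>. The same number is the parameter in the weighted arithmetic-geometric
  inequality that separates \<open>symbol\<close> from \<open>exp_sum\<close>.\<close>

definition lower_weight :: real where
  "lower_weight = (\<Sum>k=1..N. a k * (1 - decay k) * exp (- 2 * pi * w k / L)) / 8"

lemma lower_weight_pos: "lower_weight > 0"
proof -
  have "(\<Sum>k=1..N. a k * (1 - decay k) * exp (- 2 * pi * w k / L)) > 0"
    by (rule sum_pos) (use N a decay in auto)
  then show ?thesis by (simp add: lower_weight_def)
qed

text \<open>
  With \<open>v = pole_sum\<close> and \<open>D = v - r v(\<cdot> + 1/\<alpha>)\<close> one has
  \<open>2 Re (v cnj D) = |v|\<^sup>2 + |D|\<^sup>2 - r\<^sup>2 |v(\<cdot> + 1/\<alpha>)|\<^sup>2\<close>.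
\<close>

lemma symbol_test_function_pointwise:
  "(\<Sum>k=1..N. a k * exp (- 2 * pi * w k * \<xi>) *
      ((norm (pole_sum t c J k \<xi>))\<^sup>2 - (decay k)\<^sup>2 * (norm (pole_sum t c J k (\<xi> + 1/\<alpha>)))\<^sup>2) / 2)
    \<le> (norm (symbol t c J \<xi>))\<^sup>2 / (2 * lower_weight) + lower_weight / 2 * (norm (exp_sum t c J \<xi>))\<^sup>2"
proof -
  have "(\<Sum>k=1..N. a k * exp (- 2 * pi * w k * \<xi>) *
      ((norm (pole_sum t c J k \<xi>))\<^sup>2 - (decay k)\<^sup>2 * (norm (pole_sum t c J k (\<xi> + 1/\<alpha>)))\<^sup>2) / 2)
    \<le> (\<Sum>k=1..N. Re (of_real (a k * exp (- 2 * pi * w k * \<xi>)) * pole_sum t c J k \<xi> * cnj (exp_sum t c J \<xi>)))"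
  proof (rule sum_mono)
    fix k assume k: "k \<in> {1..N}"
    let ?v = "pole_sum t c J k \<xi>" and ?v' = "pole_sum t c J k (\<xi> + 1/\<alpha>)"
    have pos: "a k * exp (- 2 * pi * w k * \<xi>) \<ge> 0" using a[OF k] by simp
    have "2 * Re (?v * cnj (?v - of_real (decay k) * ?v')) =
       (norm ?v)\<^sup>2 + (norm (?v - of_real (decay k) * ?v'))\<^sup>2 - (decay k)\<^sup>2 * (norm ?v')\<^sup>2"
      unfolding cmod_power2 by (simp add: power2_eq_square algebra_simps)
    \<comment> \<open>Here \<open>z\<close> stands for the squared modulus of
      \<open>exp_sum\<close>, a nonnegative term that is dropped.\<close>
    moreover have "2 * x = y + z - d \<Longrightarrow> 0 \<le> z \<Longrightarrow> (y - d) / 2 \<le> x" for x y z d :: real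
      by (simp add: field_simps)
    ultimately have "((norm ?v)\<^sup>2 - (decay k)\<^sup>2 * (norm ?v')\<^sup>2) / 2 \<le> Re (?v * cnj (exp_sum t c J \<xi>))"
      unfolding exp_sum_pole_sum[OF k, of t c J \<xi>] using zero_le_power2 by metis
    from mult_left_mono[OF this pos]
    show "a k * exp (- 2 * pi * w k * \<xi>) * ((norm ?v)\<^sup>2 - (decay k)\<^sup>2 * (norm ?v')\<^sup>2) / 2
       \<le> Re (of_real (a k * exp (- 2 * pi * w k * \<xi>)) * ?v * cnj (exp_sum t c J \<xi>))"
      by (simp add: mult.assoc ring_distribs)
  qed
  also have "\<dots> = Re (symbol t c J \<xi> * cnj (exp_sum t c J \<xi>))"
    unfolding symbol_def sum_distrib_right Re_sum ..
  also have "\<dots> \<le> norm (symbol t c J \<xi>) * norm (exp_sum t c J \<xi>)"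
    using complex_Re_le_cmod[of "symbol t c J \<xi> * cnj (exp_sum t c J \<xi>)"] by (simp only: norm_mult complex_mod_cnj)
  also have "\<dots> \<le> (norm (symbol t c J \<xi>))\<^sup>2 / (2 * lower_weight) + lower_weight / 2 * (norm (exp_sum t c J \<xi>))\<^sup>2"
  proof -
    have "2 * lower_weight * (norm (symbol t c J \<xi>) * norm (exp_sum t c J \<xi>))
       \<le> (norm (symbol t c J \<xi>))\<^sup>2 + lower_weight\<^sup>2 * (norm (exp_sum t c J \<xi>))\<^sup>2"
      using sum_squares_bound[of "norm (symbol t c J \<xi>)" "lower_weight * norm (exp_sum t c J \<xi>)"]
      by (simp add: power_mult_distrib mult_ac)
    then show ?thesis using lower_weight_pos by (simp add: field_simps power2_eq_square)
  qed
  finally show ?thesis .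
qed

text \<open>Integrating the pointwise inequality over exactly one period \<open>[0, 1/L]\<close>
  makes shifted and unshifted terms comparable; the sum over the poles is then at least
  \<open>lower_weight * (?S / L)\<close>.\<close>

lemma symbol_lower:
  assumes J: "finite J" and density: "\<alpha> \<le> L"
  shows "lower_weight\<^sup>2 / L * (\<Sum>j\<in>J. (norm (c j))\<^sup>2) \<le> integral {0..1/\<alpha>} (\<lambda>\<xi>. (norm (symbol t c J \<xi>))\<^sup>2)"
proof -
  let ?S = "\<Sum>j\<in>J. (norm (c j))\<^sup>2" and ?v = "pole_sum t c J"
  let ?I = "\<lambda>f. integral {0..1/L} f"
  let ?\<kappa> = "lower_weight"
  let ?U = "?I (\<lambda>\<xi>. (norm (symbol t c J \<xi>))\<^sup>2)"
  let ?e = "\<lambda>k \<xi>. exp (- (2 * pi * w k) * \<xi>)"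
  have term1: "(1 - decay k) * exp (- 2 * pi * w k / L) * (?S / (4 * L))
      \<le> ?I (\<lambda>\<xi>. ?e k \<xi> * (norm (?v k \<xi>))\<^sup>2) - (decay k)\<^sup>2 * ?I (\<lambda>\<xi>. ?e k \<xi> * (norm (?v k (\<xi> + 1/\<alpha>)))\<^sup>2)"
    if k: "k \<in> {1..N}" for k
  proof -
    let ?W = "?I (\<lambda>\<xi>. ?e k \<xi> * (norm (?v k \<xi>))\<^sup>2)"
    \<comment> \<open>The shift costs at most \<open>1 / decay k\<close> and the shifted term comes
      with \<open>(decay k)\<^sup>2\<close>; subtracting it therefore leaves a share
      \<open>1 - decay k\<close> of \<open>?W\<close>.\<close>
    have "?I (\<lambda>\<xi>. ?e k \<xi> * (norm (?v k (\<xi> + 1/\<alpha>)))\<^sup>2) \<le> exp (2 * pi * w k * (1/\<alpha>)) * ?W"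
      by (rule integral_exp_periodic_shift_le)
         (use L \<alpha> w[OF k] norm_exp_sum_periodic in \<open>auto intro!: continuous_intros simp: pole_sum_def\<close>)
    then have "(decay k)\<^sup>2 * ?I (\<lambda>\<xi>. ?e k \<xi> * (norm (?v k (\<xi> + 1/\<alpha>)))\<^sup>2) \<le> (decay k)\<^sup>2 * (exp (2 * pi * w k * (1/\<alpha>)) * ?W)"
      by (rule mult_left_mono) simp
    also have "\<dots> = decay k * (decay k * exp (2 * pi * w k / \<alpha>)) * ?W"
      by (simp add: power2_eq_square)
    also have "decay k * exp (2 * pi * w k / \<alpha>) = 1"
      by (simp add: decay_def flip: exp_add)
    finally have 1: "(decay k)\<^sup>2 * ?I (\<lambda>\<xi>. ?e k \<xi> * (norm (?v k (\<xi> + 1/\<alpha>)))\<^sup>2) \<le> decay k * ?W" by simp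
    have "exp (- 2 * pi * w k / L) * ?I (\<lambda>\<xi>. (norm (?v k \<xi>))\<^sup>2) = ?I (\<lambda>\<xi>. exp (- 2 * pi * w k / L) * (norm (?v k \<xi>))\<^sup>2)"
      by simp
    also have "\<dots> \<le> ?W"
    proof (rule integral_le)
      fix \<xi> assume "\<xi> \<in> {0..1/L}"
      then have "2 * pi * w k * \<xi> \<le> 2 * pi * w k * (1/L)"
        using w[OF k] by (intro mult_left_mono) auto
      then have "exp (- 2 * pi * w k / L) \<le> ?e k \<xi>" by simp
      then show "exp (- 2 * pi * w k / L) * (norm (?v k \<xi>))\<^sup>2 \<le> ?e k \<xi> * (norm (?v k \<xi>))\<^sup>2"
        by (rule mult_right_mono) simp
    qed (auto intro!: integrable_continuous_interval continuous_intros)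
    finally have "exp (- 2 * pi * w k / L) * ?I (\<lambda>\<xi>. (norm (?v k \<xi>))\<^sup>2) \<le> ?W" .
    moreover have "exp (- 2 * pi * w k / L) * (?S / (4 * L)) \<le> exp (- 2 * pi * w k / L) * ?I (\<lambda>\<xi>. (norm (?v k \<xi>))\<^sup>2)"
      by (intro mult_left_mono integral_pole_sum_bounds[OF J k]) simp
    ultimately have "exp (- 2 * pi * w k / L) * (?S / (4 * L)) \<le> ?W" by linarith
    then have "(1 - decay k) * (exp (- 2 * pi * w k / L) * (?S / (4 * L))) \<le> (1 - decay k) * ?W"
      using decay[OF k] by (intro mult_left_mono) auto
    also have "\<dots> = ?W - decay k * ?W" by (simp add: left_diff_distrib)
    finally show ?thesis using 1 by (simp only: mult.assoc)
  qed
  have "?\<kappa> * (?S / L) = (\<Sum>k=1..N. a k / 2 * ((1 - decay k) * exp (- 2 * pi * w k / L) * (?S / (4 * L))))"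
    unfolding lower_weight_def sum_divide_distrib[of _ _ 8] sum_distrib_right
    by (intro sum.cong refl) (simp add: mult_ac)
  also have "\<dots> \<le> (\<Sum>k=1..N. a k / 2 * (?I (\<lambda>\<xi>. ?e k \<xi> * (norm (?v k \<xi>))\<^sup>2)
     - (decay k)\<^sup>2 * ?I (\<lambda>\<xi>. ?e k \<xi> * (norm (?v k (\<xi> + 1/\<alpha>)))\<^sup>2)))"
    by (intro sum_mono mult_left_mono term1) (use a less_imp_le in auto)
  also have "\<dots> = (\<Sum>k=1..N. ?I (\<lambda>\<xi>. a k / 2 * (?e k \<xi> * (norm (?v k \<xi>))\<^sup>2
     - (decay k)\<^sup>2 * (?e k \<xi> * (norm (?v k (\<xi> + 1/\<alpha>)))\<^sup>2))))"
  proof (intro sum.cong refl)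
    fix k
    have "(\<lambda>\<xi>. ?e k \<xi> * (norm (?v k \<xi>))\<^sup>2) integrable_on {0..1/L}"
      "(\<lambda>\<xi>. (decay k)\<^sup>2 * (?e k \<xi> * (norm (?v k (\<xi> + 1/\<alpha>)))\<^sup>2)) integrable_on {0..1/L}"
      by (auto intro!: integrable_continuous_interval continuous_intros
           continuous_on_compose2[OF continuous_pole_sum[of UNIV]])
    then show "a k / 2 * (?I (\<lambda>\<xi>. ?e k \<xi> * (norm (?v k \<xi>))\<^sup>2)
       - (decay k)\<^sup>2 * ?I (\<lambda>\<xi>. ?e k \<xi> * (norm (?v k (\<xi> + 1/\<alpha>)))\<^sup>2))
      = ?I (\<lambda>\<xi>. a k / 2 * (?e k \<xi> * (norm (?v k \<xi>))\<^sup>2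
     - (decay k)\<^sup>2 * (?e k \<xi> * (norm (?v k (\<xi> + 1/\<alpha>)))\<^sup>2)))"
      by (subst integral_mult_right) (subst integral_diff, auto simp only: integral_mult_right)
  qed
  also have "\<dots> = ?I (\<lambda>\<xi>. \<Sum>k=1..N. a k / 2 * (?e k \<xi> * (norm (?v k \<xi>))\<^sup>2
     - (decay k)\<^sup>2 * (?e k \<xi> * (norm (?v k (\<xi> + 1/\<alpha>)))\<^sup>2)))"
    by (subst integral_sum)
       (auto intro!: integrable_continuous_interval continuous_intros
           continuous_on_compose2[OF continuous_pole_sum[of UNIV]])
  also have "\<dots> \<le> ?I (\<lambda>\<xi>. (norm (symbol t c J \<xi>))\<^sup>2 / (2 * ?\<kappa>) + ?\<kappa> / 2 * (norm (exp_sum t c J \<xi>))\<^sup>2)"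
  proof (rule integral_le)
    fix \<xi>
    have "(\<Sum>k=1..N. a k / 2 * (?e k \<xi> * (norm (?v k \<xi>))\<^sup>2
     - (decay k)\<^sup>2 * (?e k \<xi> * (norm (?v k (\<xi> + 1/\<alpha>)))\<^sup>2))) =
      (\<Sum>k=1..N. a k * exp (- 2 * pi * w k * \<xi>) *
      ((norm (?v k \<xi>))\<^sup>2 - (decay k)\<^sup>2 * (norm (?v k (\<xi> + 1/\<alpha>)))\<^sup>2) / 2)"
      by (intro sum.cong refl) (simp add: algebra_simps)
    from this symbol_test_function_pointwise
    show "(\<Sum>k=1..N. a k / 2 * (?e k \<xi> * (norm (?v k \<xi>))\<^sup>2
     - (decay k)\<^sup>2 * (?e k \<xi> * (norm (?v k (\<xi> + 1/\<alpha>)))\<^sup>2)))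
      \<le> (norm (symbol t c J \<xi>))\<^sup>2 / (2 * ?\<kappa>) + ?\<kappa> / 2 * (norm (exp_sum t c J \<xi>))\<^sup>2"
      by (rule ord_eq_le_trans)
  qed (use lower_weight_pos in \<open>auto intro!: integrable_continuous_interval continuous_intros
           continuous_on_compose2[OF continuous_pole_sum[of UNIV]]\<close>)
  also have "\<dots> = ?U / (2 * ?\<kappa>) + ?\<kappa> / 2 * (?S / L)"
  proof -
    have "(\<lambda>\<xi>. (norm (symbol t c J \<xi>))\<^sup>2 / (2 * ?\<kappa>)) integrable_on {0..1/L}"
      "(\<lambda>\<xi>. ?\<kappa> / 2 * (norm (exp_sum t c J \<xi>))\<^sup>2) integrable_on {0..1/L}"
      using lower_weight_pos by (auto intro!: integrable_continuous_interval continuous_intros)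
    then show ?thesis
      by (subst integral_add) (auto simp: integral_exp_sum[OF J])
  qed
  \<comment> \<open>Since \<open>exp_sum\<close> has squared norm exactly \<open>?S / L\<close>, the
    last summand is half of the left side and is absorbed.\<close>
  finally have "?\<kappa>\<^sup>2 / L * ?S \<le> ?U"
    using lower_weight_pos L by (simp add: field_simps power2_eq_square)
  \<comment> \<open>The density condition enters here: the period used for testing fits inside
    \<open>[0, 1/\<alpha>]\<close>, where the Fourier coefficients of \<open>symbol\<close> are
    taken.\<close>
  also have "?U \<le> integral {0..1/\<alpha>} (\<lambda>\<xi>. (norm (symbol t c J \<xi>))\<^sup>2)"
  proof (rule integral_subset_le)
    have "1 / L \<le> 1 / \<alpha>" using density \<alpha> by (intro frac_le) auto
    then show "{0..1/L} \<subseteq> {0..1/\<alpha>}" by auto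
  qed (auto intro!: integrable_continuous_interval continuous_intros)
  finally show ?thesis .
qed

definition lower_const :: real where
  "lower_const = 4 * pi\<^sup>2 / \<alpha> * (lower_weight\<^sup>2 / L)"

lemma lower_const_pos: "lower_const > 0"
  unfolding lower_const_def using lower_weight_pos \<alpha> L by simp

lemma upper_const_nonneg: "upper_const \<ge> 0"
  unfolding upper_const_def using \<alpha> L
  by (intro mult_nonneg_nonneg sum_nonneg divide_nonneg_nonneg of_nat_0_le_iff) auto

lemma nn_integral_fiber_value:
  "(\<integral>\<^sup>+m. ennreal ((norm (fiber_value t c J m))\<^sup>2) \<partial>count_space UNIV)
    = ennreal (4 * pi\<^sup>2 / \<alpha> * integral {0..1/\<alpha>} (\<lambda>\<xi>. (norm (symbol t c J \<xi>))\<^sup>2))"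
proof (rule nn_integral_count_space_has_sum[THEN iffD2, OF _ _ fiber_value_has_sum])
  have "0 \<le> integral {0..1/\<alpha>} (\<lambda>\<xi>. (norm (symbol t c J \<xi>))\<^sup>2)"
    by (rule Henstock_Kurzweil_Integration.integral_nonneg)
       (auto intro!: integrable_continuous_interval continuous_intros)
  then show "0 \<le> 4 * pi\<^sup>2 / \<alpha> * integral {0..1/\<alpha>} (\<lambda>\<xi>. (norm (symbol t c J \<xi>))\<^sup>2)"
    using \<alpha> by simp
qed simp

lemma finite_fiber_upper:
  assumes "finite J"
  shows "(\<integral>\<^sup>+m. ennreal ((norm (fiber_value t c J m))\<^sup>2) \<partial>count_space UNIV)
     \<le> ennreal (upper_const * (\<Sum>j\<in>J. (norm (c j))\<^sup>2))"
  unfolding nn_integral_fiber_value by (rule ennreal_leI) (rule symbol_upper[OF assms])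

lemma finite_fiber_lower:
  assumes "finite J" "\<alpha> \<le> L"
  shows "ennreal (lower_const * (\<Sum>j\<in>J. (norm (c j))\<^sup>2)) \<le>
     (\<integral>\<^sup>+m. ennreal ((norm (fiber_value t c J m))\<^sup>2) \<partial>count_space UNIV)"
  unfolding nn_integral_fiber_value lower_const_def mult.assoc[of "4 * pi\<^sup>2 / \<alpha>"]
  using symbol_lower[OF assms, of c t] \<alpha> by (intro ennreal_leI mult_left_mono) auto

end

section \<open>Square-summable sequences\<close>

lemma nn_integral_count_space_le:
  fixes f :: "'a \<Rightarrow> real"
  assumes f: "\<And>x. f x \<ge> 0" and S: "\<And>F. finite F \<Longrightarrow> sum f F \<le> S"
  shows "(\<integral>\<^sup>+x. ennreal (f x) \<partial>count_space UNIV) \<le> ennreal S"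
proof -
  have summ: "f summable_on UNIV"
    by (rule nonneg_bdd_above_summable_on) (use f S in \<open>auto intro!: bdd_aboveI\<close>)
  have le: "infsum f UNIV \<le> S"
    by (rule infsum_le_finite_sums[OF summ S])
  have "(\<integral>\<^sup>+x. ennreal (f x) \<partial>count_space UNIV) = ennreal (infsum f UNIV)"
    by (rule nn_integral_count_space_has_sum[THEN iffD2]) (use f summ in \<open>auto intro!: infsum_nonneg\<close>)
  then show ?thesis using le by (simp add: ennreal_leI)
qed

lemma integral_count_space_finite_sum:
  fixes f :: "'a \<Rightarrow> 'b::{banach, second_countable_topology}"
  assumes "finite J"
  shows "(LINT j|count_space UNIV. (if j \<in> J then f j else 0)) = sum f J"
proof -
  have fin: "finite {j \<in> UNIV. (if j \<in> J then f j else 0) \<noteq> 0}"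
    by (rule finite_subset[OF _ assms]) auto
  show ?thesis
    unfolding lebesgue_integral_count_space_finite_support[OF fin]
    by (rule sum.mono_neutral_cong_left) (use assms in auto)
qed

text \<open>Lets statements for finite supports pass to the limit along a sequence of intervals
  exhausting the integers.\<close>

lemma symmetric_partial_sums_tendsto:
  fixes f :: "int \<Rightarrow> 'b::{banach, second_countable_topology}"
  assumes "integrable (count_space UNIV) f"
  shows "(\<lambda>n. \<Sum>j\<in>{- int n..int n}. f j) \<longlonglongrightarrow> (LINT j|count_space UNIV. f j)"
proof -
  have "(\<lambda>n. LINT j|count_space UNIV. (if j \<in> {- int n..int n} then f j else 0))
     \<longlonglongrightarrow> (LINT j|count_space UNIV. f j)"
  proof (rule integral_dominated_convergence[where w = "\<lambda>j. norm (f j)"])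
    show "AE j in count_space UNIV. (\<lambda>n. if j \<in> {- int n..int n} then f j else 0) \<longlonglongrightarrow> f j"
    proof (rule AE_I2, rule tendsto_eventually)
      fix j
      show "\<forall>\<^sub>F n in sequentially. (if j \<in> {- int n..int n} then f j else 0) = f j"
        using eventually_ge_at_top[of "nat \<bar>j\<bar>"] by eventually_elim auto
    qed
  qed (use assms in auto)
  then show ?thesis unfolding integral_count_space_finite_sum[OF finite_atLeastAtMost_int] .
qed

section \<open>Fiber bounds for infinite sequences\<close>

context herglotz_window
begin

text \<open>Duality: for coefficients conjugate to the samples of the window, the single value
  \<open>fiber_value t ?c J m\<close> is the sum \<open>?S\<close> itself. Keeping only this
  \<open>m\<close> in the upper bound gives \<open>?S\<^sup>2 \<le> upper_const * ?S\<close>,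
  uniformly in \<open>t\<close> and \<open>m\<close>.\<close>

lemma window_sum_bound:
  assumes J: "finite J"
  shows "(\<Sum>j\<in>J. (norm (g (t + of_int j * L - \<alpha> * of_int m)))\<^sup>2) \<le> upper_const"
proof -
  let ?c = "\<lambda>j. cnj (g (t + of_int j * L - \<alpha> * of_int m))"
  let ?S = "\<Sum>j\<in>J. (norm (g (t + of_int j * L - \<alpha> * of_int m)))\<^sup>2"
  have S0: "?S \<ge> 0" by (simp add: sum_nonneg)
  have cnj_mult: "cnj z * z = of_real ((norm z)\<^sup>2)" for z
    by (simp only: complex_norm_square mult.commute[of "cnj z" z])
  have "fiber_value t ?c J m = of_real ?S"
    unfolding fiber_value_def of_real_sum
    by (intro sum.cong refl) (rule cnj_mult)
  then have "norm (fiber_value t ?c J m) = ?S" using S0 by (simp only: norm_of_real abs_of_nonneg)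
  then have "ennreal (?S\<^sup>2) = ennreal ((norm (fiber_value t ?c J m))\<^sup>2)" by simp
  also have "\<dots> \<le> (\<integral>\<^sup>+m. ennreal ((norm (fiber_value t ?c J m))\<^sup>2) \<partial>count_space UNIV)"
    by (rule nn_integral_ge_point) simp
  also have "\<dots> \<le> ennreal (upper_const * ?S)"
    using finite_fiber_upper[OF J, of t ?c] by simp
  finally have "?S\<^sup>2 \<le> upper_const * ?S"
    using upper_const_nonneg S0 by (simp add: ennreal_le_iff)
  then show ?thesis
    using S0 upper_const_nonneg by (cases "?S = 0") (auto simp: power2_eq_square)
qed

lemma window_square_summable:
  "(\<integral>\<^sup>+j. ennreal ((norm (g (t + of_int j * L - \<alpha> * of_int m)))\<^sup>2) \<partial>count_space UNIV) \<le> ennreal upper_const"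
  by (rule nn_integral_count_space_le) (auto intro: window_sum_bound)

text \<open>An absolutely convergent sum, written over counting measure so that dominated
  convergence and Fubini apply; without absolute summability its value is 0 by convention.\<close>

definition fiber :: "real \<Rightarrow> (int \<Rightarrow> complex) \<Rightarrow> int \<Rightarrow> complex" where
  "fiber t c m = (LINT j|count_space UNIV. c j * g (t + of_int j * L - \<alpha> * of_int m))"

lemma integrable_fiber:
  assumes "integrable (count_space UNIV) (\<lambda>j. (norm (c j))\<^sup>2)"
  shows "integrable (count_space UNIV) (\<lambda>j. c j * g (t + of_int j * L - \<alpha> * of_int m))"
proof (rule integrable_norm_sq_mult[OF _ _ assms])
  show "integrable (count_space UNIV) (\<lambda>j. (norm (g (t + of_int j * L - \<alpha> * of_int m)))\<^sup>2)"
    by (rule integrableI_nonneg)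
       (auto intro: le_less_trans[OF window_square_summable])
qed auto

lemma fiber_value_tendsto:
  assumes "integrable (count_space UNIV) (\<lambda>j. (norm (c j))\<^sup>2)"
  shows "(\<lambda>n. fiber_value t c {- int n..int n} m) \<longlonglongrightarrow> fiber t c m"
  unfolding fiber_value_def fiber_def
  by (rule symmetric_partial_sums_tendsto) (rule integrable_fiber[OF assms])

text \<open>Fatou over the truncations to \<open>{- n..n}\<close>, whose values converge for each
  \<open>m\<close> and obey the finite bound.\<close>

lemma fiber_upper:
  assumes c: "integrable (count_space UNIV) (\<lambda>j. (norm (c j))\<^sup>2)"
  shows "(\<integral>\<^sup>+m. ennreal ((norm (fiber t c m))\<^sup>2) \<partial>count_space UNIV)
     \<le> ennreal (upper_const * (LINT j|count_space UNIV. (norm (c j))\<^sup>2))"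
proof -
  let ?S = "LINT j|count_space UNIV. (norm (c j))\<^sup>2"
  let ?y = "\<lambda>n m. fiber_value t c {- int n..int n} m"
  have lim: "(\<lambda>n. ennreal ((norm (?y n m))\<^sup>2)) \<longlonglongrightarrow> ennreal ((norm (fiber t c m))\<^sup>2)" for m
    by (intro tendsto_ennrealI tendsto_intros fiber_value_tendsto[OF c])
  have "(\<integral>\<^sup>+m. ennreal ((norm (fiber t c m))\<^sup>2) \<partial>count_space UNIV)
     = (\<integral>\<^sup>+m. liminf (\<lambda>n. ennreal ((norm (?y n m))\<^sup>2)) \<partial>count_space UNIV)"
    by (intro nn_integral_cong lim_imp_Liminf[symmetric] lim) simp
  also have "\<dots> \<le> liminf (\<lambda>n. \<integral>\<^sup>+m. ennreal ((norm (?y n m))\<^sup>2) \<partial>count_space UNIV)"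
    by (rule nn_integral_liminf) simp
  also have "\<dots> \<le> liminf (\<lambda>n. ennreal (upper_const * ?S))"
  proof (rule Liminf_mono, rule always_eventually, rule allI)
    fix n
    have "(\<Sum>j\<in>{- int n..int n}. (norm (c j))\<^sup>2) = (LINT j|count_space UNIV. (if j \<in> {- int n..int n} then (norm (c j))\<^sup>2 else 0))"
      by (rule integral_count_space_finite_sum[symmetric]) simp
    also have "\<dots> \<le> ?S"
    proof (rule integral_mono[OF _ c])
      show "integrable (count_space UNIV) (\<lambda>j. if j \<in> {- int n..int n} then (norm (c j))\<^sup>2 else 0)"
        by (rule Bochner_Integration.integrable_bound[OF c]) auto
    qed auto
    finally have "upper_const * (\<Sum>j\<in>{- int n..int n}. (norm (c j))\<^sup>2) \<le> upper_const * ?S"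
      using upper_const_nonneg by (rule mult_left_mono)
    then show "(\<integral>\<^sup>+m. ennreal ((norm (?y n m))\<^sup>2) \<partial>count_space UNIV) \<le> ennreal (upper_const * ?S)"
      using finite_fiber_upper[of "{- int n..int n}" t c] by (meson ennreal_leI finite_atLeastAtMost_int order_trans)
  qed
  finally show ?thesis by (simp add: Liminf_const)
qed

text \<open>Fatou points in the wrong direction here. Instead \<open>c\<close> is split into a
  truncation, to which the finite bound applies, and a tail \<open>d\<close>, whose contribution
  \<open>fiber_upper\<close> drives to zero. The inequality
  \<open>|x - y|^2 \<le> 2|x|^2 + 2|y|^2\<close> costs the factor 1/2.\<close>

lemma fiber_lower:
  assumes c: "integrable (count_space UNIV) (\<lambda>j. (norm (c j))\<^sup>2)" and density: "\<alpha> \<le> L"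
  shows "ennreal (lower_const / 2 * (LINT j|count_space UNIV. (norm (c j))\<^sup>2))
     \<le> (\<integral>\<^sup>+m. ennreal ((norm (fiber t c m))\<^sup>2) \<partial>count_space UNIV)"
proof -
  let ?C = "count_space (UNIV :: int set)"
  let ?S = "LINT j|?C. (norm (c j))\<^sup>2"
  define s where "s n = (\<Sum>j\<in>{- int n..int n}. (norm (c j))\<^sup>2)" for n
  obtain Y where Y: "Y \<ge> 0" "(\<integral>\<^sup>+m. ennreal ((norm (fiber t c m))\<^sup>2) \<partial>?C) = ennreal Y"
    using fiber_upper[OF c, of t]
    by (cases "\<integral>\<^sup>+m. ennreal ((norm (fiber t c m))\<^sup>2) \<partial>?C") (auto simp: top_unique)
  have key: "lower_const * s n \<le> 2 * Y + 2 * (upper_const * (?S - s n))" for n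
  proof -
    let ?J = "{- int n..int n}"
    define d where "d j = (if j \<in> ?J then 0 else c j)" for j
    have d: "integrable ?C (\<lambda>j. (norm (d j))\<^sup>2)"
      by (rule Bochner_Integration.integrable_bound[OF c]) (auto simp: d_def)
    have i1: "integrable ?C (\<lambda>j. if j \<in> ?J then (norm (c j))\<^sup>2 else 0)"
      by (rule Bochner_Integration.integrable_bound[OF c]) auto
    have "(LINT j|?C. (norm (d j))\<^sup>2) = (LINT j|?C. (norm (c j))\<^sup>2 - (if j \<in> ?J then (norm (c j))\<^sup>2 else 0))"
      by (rule Bochner_Integration.integral_cong) (auto simp: d_def)
    also have "\<dots> = ?S - s n"
      unfolding s_def using c i1 by (simp only: Bochner_Integration.integral_diff integral_count_space_finite_sum finite_atLeastAtMost_int)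
    finally have d_int: "(LINT j|?C. (norm (d j))\<^sup>2) = ?S - s n" .
    have S0: "0 \<le> ?S - s n" unfolding d_int[symmetric] by (rule Bochner_Integration.integral_nonneg) simp
    have split: "fiber_value t c ?J m = fiber t c m - fiber t d m" for m
    proof -
      let ?g = "\<lambda>j. g (t + of_int j * L - \<alpha> * of_int m)"
      have "fiber_value t c ?J m = (LINT j|?C. (if j \<in> ?J then c j * ?g j else 0))"
        unfolding fiber_value_def by (rule integral_count_space_finite_sum[symmetric]) simp
      also have "\<dots> = (LINT j|?C. c j * ?g j - d j * ?g j)"
        by (rule Bochner_Integration.integral_cong) (auto simp: d_def)
      also have "\<dots> = fiber t c m - fiber t d m"
        unfolding fiber_def by (rule Bochner_Integration.integral_diff) (auto intro: integrable_fiber c d)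
      finally show ?thesis .
    qed
    have pt: "(norm (fiber_value t c ?J m))\<^sup>2 \<le> 2 * (norm (fiber t c m))\<^sup>2 + 2 * (norm (fiber t d m))\<^sup>2" for m
    proof -
      have "(norm (fiber_value t c ?J m))\<^sup>2 \<le> (norm (fiber t c m) + norm (fiber t d m))\<^sup>2"
        unfolding split by (intro power_mono norm_triangle_ineq4) simp
      then show ?thesis
        using sum_squares_bound[of "norm (fiber t c m)" "norm (fiber t d m)"] by (simp add: power2_sum)
    qed
    have "ennreal (lower_const * s n) \<le> (\<integral>\<^sup>+m. ennreal ((norm (fiber_value t c ?J m))\<^sup>2) \<partial>?C)"
      unfolding s_def by (rule finite_fiber_lower[OF _ density]) simp
    also have "\<dots> \<le> (\<integral>\<^sup>+m. ennreal (2 * (norm (fiber t c m))\<^sup>2 + 2 * (norm (fiber t d m))\<^sup>2) \<partial>?C)"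
      by (intro nn_integral_mono ennreal_leI pt)
    also have "\<dots> = (\<integral>\<^sup>+m. ennreal 2 * ennreal ((norm (fiber t c m))\<^sup>2) + ennreal 2 * ennreal ((norm (fiber t d m))\<^sup>2) \<partial>?C)"
      by (intro nn_integral_cong) (simp add: ennreal_mult')
    also have "\<dots> = ennreal 2 * ennreal Y + ennreal 2 * (\<integral>\<^sup>+m. ennreal ((norm (fiber t d m))\<^sup>2) \<partial>?C)"
      by (subst nn_integral_add) (auto simp: nn_integral_cmult Y(2))
    also have "\<dots> \<le> ennreal 2 * ennreal Y + ennreal 2 * ennreal (upper_const * (?S - s n))"
      using fiber_upper[OF d, of t] unfolding d_int by (intro add_left_mono mult_left_mono) auto
    also have "\<dots> = ennreal (2 * Y + 2 * (upper_const * (?S - s n)))"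
    proof -
      define K where "K = upper_const * (?S - s n)"
      have "K \<ge> 0" using S0 upper_const_nonneg by (simp add: K_def)
      then show ?thesis unfolding K_def[symmetric] using Y(1) by (simp add: ennreal_mult')
    qed
    finally show ?thesis
      using Y(1) S0 upper_const_nonneg by (subst (asm) ennreal_le_iff) auto
  qed
  have lim: "s \<longlonglongrightarrow> ?S"
    unfolding s_def by (rule symmetric_partial_sums_tendsto[OF c])
  have "(\<lambda>n. lower_const * s n) \<longlonglongrightarrow> lower_const * ?S"
    "(\<lambda>n. 2 * Y + 2 * (upper_const * (?S - s n))) \<longlonglongrightarrow> 2 * Y + 2 * (upper_const * (?S - ?S))"
    by (intro tendsto_intros lim)+
  then have "lower_const * ?S \<le> 2 * Y + 2 * (upper_const * (?S - ?S))"
    by (rule LIMSEQ_le) (use key in blast)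
  then show ?thesis unfolding Y(2) by (intro ennreal_leI) simp
qed

end

section \<open>Fiberization\<close>

text \<open>Every real \<open>x\<close> lies in exactly one translate of \<open>[0, L)\<close>, the
  one with index \<open>\<lfloor>x / L\<rfloor>\<close>; Tonelli does the rest.\<close>

lemma nn_integral_periodize:
  fixes F :: "real \<Rightarrow> ennreal"
  assumes L: "L > 0" and F [measurable]: "F \<in> borel_measurable borel"
  shows "(\<integral>\<^sup>+x. F x \<partial>lborel) = (\<integral>\<^sup>+t. (\<integral>\<^sup>+j. F (t + of_int j * L) \<partial>count_space (UNIV :: int set)) \<partial>period_measure L)"
proof -
  have uniq: "{j :: int. x - of_int j * L \<in> {0..<L}} = {\<lfloor>x / L\<rfloor>}" for x
  proof -
    have "x - of_int j * L \<in> {0..<L} \<longleftrightarrow> of_int j \<le> x / L \<and> x / L < of_int j + 1" for j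
      using L by (auto simp: field_simps)
    then show ?thesis by (auto simp: floor_eq_iff[symmetric] eq_commute)
  qed
  have "(\<integral>\<^sup>+t. (\<integral>\<^sup>+j. F (t + of_int j * L) \<partial>count_space (UNIV :: int set)) \<partial>period_measure L)
     = (\<integral>\<^sup>+j. (\<integral>\<^sup>+t. F (t + of_int j * L) \<partial>period_measure L) \<partial>count_space (UNIV :: int set))"
    by (rule nn_integral_count_space_nn_integral) (auto intro: measurable_restrict_space1)
  also have "\<dots> = (\<integral>\<^sup>+j. (\<integral>\<^sup>+t. F (t + of_int j * L) * indicator {0..<L} t \<partial>lborel) \<partial>count_space (UNIV :: int set))"
    by (simp add: nn_integral_restrict_space)
  also have "\<dots> = (\<integral>\<^sup>+j. (\<integral>\<^sup>+x. F x * indicator {0..<L} (x - of_int j * L) \<partial>lborel) \<partial>count_space (UNIV :: int set))"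
  proof (rule nn_integral_cong)
    fix j :: int
    show "(\<integral>\<^sup>+t. F (t + of_int j * L) * indicator {0..<L} t \<partial>lborel) = (\<integral>\<^sup>+x. F x * indicator {0..<L} (x - of_int j * L) \<partial>lborel)"
      using nn_integral_real_affine[of "\<lambda>x. F x * indicator {0..<L} (x - of_int j * L)" 1 "of_int j * L"]
      by (simp add: add.commute)
  qed
  also have "\<dots> = (\<integral>\<^sup>+x. (\<integral>\<^sup>+j. F x * indicator {0..<L} (x - of_int j * L) \<partial>count_space (UNIV :: int set)) \<partial>lborel)"
    by (rule nn_integral_count_space_nn_integral[symmetric]) auto
  also have "\<dots> = (\<integral>\<^sup>+x. F x \<partial>lborel)"
  proof (rule nn_integral_cong)
    fix x
    have "(\<integral>\<^sup>+j. F x * indicator {0..<L} (x - of_int j * L) \<partial>count_space (UNIV :: int set))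
       = (\<integral>\<^sup>+j. F x * indicator {\<lfloor>x / L\<rfloor>} j \<partial>count_space (UNIV :: int set))"
      using uniq[of x] by (intro nn_integral_cong) (auto simp: indicator_def set_eq_iff)
    also have "\<dots> = F x" by (simp add: nn_integral_cmult)
    finally show "(\<integral>\<^sup>+j. F x * indicator {0..<L} (x - of_int j * L) \<partial>count_space (UNIV :: int set)) = F x" .
  qed
  finally show ?thesis by (rule sym)
qed

lemma period_translation_measurable [measurable]:
  "(\<lambda>(t, j). t + of_int j * L) \<in> measurable (period_measure L \<Otimes>\<^sub>M count_space (UNIV :: int set)) borel"
proof -
  have [measurable]: "(\<lambda>t. t) \<in> measurable (period_measure L) borel"
    by (rule measurable_restrict_space1) simp
  have [measurable]: "fst \<in> measurable (period_measure L \<Otimes>\<^sub>M count_space (UNIV :: int set)) borel"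
    by (rule measurable_compose[OF measurable_fst]) measurable
  have [measurable]: "(\<lambda>p. of_int (snd p) :: real) \<in> measurable (period_measure L \<Otimes>\<^sub>M count_space (UNIV :: int set)) borel"
    by (rule measurable_compose[OF measurable_snd]) simp
  show ?thesis by (simp add: case_prod_beta)
qed

lemma sigma_finite_count_int: "sigma_finite_measure (count_space (UNIV :: int set))"
  by (rule sigma_finite_measure_count_space_countable) auto

text \<open>Image-measure form of the periodization, so that Fubini unfolds integrals of complex
  functions and not only of nonnegative ones.\<close>

lemma lborel_periodize:
  assumes L: "L > 0"
  shows "lborel = distr (period_measure L \<Otimes>\<^sub>M count_space (UNIV :: int set)) borel (\<lambda>(t, j). t + of_int j * L)"
proof (rule measure_eqI)
  interpret sigma_finite_measure "count_space (UNIV :: int set)" by (rule sigma_finite_count_int)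
  let ?P = "period_measure L \<Otimes>\<^sub>M count_space (UNIV :: int set)" and ?T = "\<lambda>(t, j :: int). t + of_int j * L"
  fix A :: "real set" assume "A \<in> sets lborel"
  then have A [measurable]: "A \<in> sets borel" by simp
  have "emeasure lborel A = (\<integral>\<^sup>+x. indicator A x \<partial>lborel)" by simp
  also have "\<dots> = (\<integral>\<^sup>+t. (\<integral>\<^sup>+j. indicator A (t + of_int j * L) \<partial>count_space (UNIV :: int set)) \<partial>period_measure L)"
    by (rule nn_integral_periodize[OF L]) simp
  also have "\<dots> = (\<integral>\<^sup>+p. indicator A (?T p) \<partial>?P)"
    by (subst nn_integral_fst[symmetric]) auto
  also have "\<dots> = (\<integral>\<^sup>+x. indicator A x \<partial>distr ?P borel ?T)"
    by (rule nn_integral_distr[symmetric]) auto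
  finally show "emeasure lborel A = emeasure (distr ?P borel ?T) A" by simp
qed simp

lemma integral_periodize:
  fixes F :: "real \<Rightarrow> complex"
  assumes L: "L > 0" and F: "integrable lborel F"
  shows "(LINT x|lborel. F x) = (LINT t|period_measure L. LINT j|count_space (UNIV :: int set). F (t + of_int j * L))"
proof -
  let ?P = "period_measure L \<Otimes>\<^sub>M count_space (UNIV :: int set)" and ?T = "\<lambda>(t, j :: int). t + of_int j * L"
  interpret finite_measure "period_measure L" by (rule finite_measure_period)
  interpret P: pair_sigma_finite "period_measure L" "count_space (UNIV :: int set)"
    unfolding pair_sigma_finite_def using sigma_finite_measure_axioms sigma_finite_count_int by blast
  have [measurable]: "F \<in> borel_measurable borel" using F by (auto dest: borel_measurable_integrable)
  have "integrable (distr ?P borel ?T) F" using F lborel_periodize[OF L] by simp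
  then have i: "integrable ?P (\<lambda>p. F (?T p))" by (subst (asm) integrable_distr_eq) auto
  have "(LINT x|lborel. F x) = (LINT x|distr ?P borel ?T. F x)" using lborel_periodize[OF L] by simp
  also have "\<dots> = (LINT p|?P. F (?T p))" by (rule integral_distr) auto
  also have "\<dots> = (LINT t|period_measure L. LINT j|count_space (UNIV :: int set). F (?T (t, j)))"
    by (rule P.integral_fst'[symmetric]) (use i in simp)
  finally show ?thesis by simp
qed

lemma measurable_translates:
  fixes L :: real
  assumes "h \<in> borel_measurable borel"
  shows "(\<lambda>p. h (fst p + of_int (snd p) * L)) \<in> borel_measurable (borel \<Otimes>\<^sub>M count_space (UNIV :: int set))"
proof -
  have "(\<lambda>p. real_of_int (snd p)) \<in> measurable (borel \<Otimes>\<^sub>M count_space (UNIV :: int set)) borel"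
    by (rule measurable_compose[OF measurable_snd]) simp
  then have "(\<lambda>p. fst p + of_int (snd p) * L) \<in> measurable (borel \<Otimes>\<^sub>M count_space (UNIV :: int set)) borel"
    by (intro borel_measurable_add borel_measurable_times measurable_fst) auto
  then show ?thesis by (rule measurable_compose) (rule assms)
qed

lemma borel_measurable_cnj:
  "f \<in> borel_measurable M \<Longrightarrow> (\<lambda>x. cnj (f x)) \<in> borel_measurable M"
  by (rule borel_measurable_continuous_on[OF continuous_on_cnj[OF continuous_on_id]])

section \<open>Energy of the Gabor coefficients\<close>

context herglotz_window
begin

lemma g_measurable [measurable]: "g \<in> borel_measurable borel"
proof -
  have "g = (\<lambda>t. \<Sum>k=1..N. of_real (a k) / (of_real t - \<i> * of_real (w k)))" using g by (rule ext)
  then show ?thesis by simp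
qed

text \<open>Square-integrability of the window is read off from the uniform bound on its samples,
  integrated over one period.\<close>

lemma nn_integral_window: "(\<integral>\<^sup>+x. ennreal ((norm (g (x - \<alpha> * of_int m)))\<^sup>2) \<partial>lborel) < \<infinity>"
proof -
  have "(\<integral>\<^sup>+x. ennreal ((norm (g (x - \<alpha> * of_int m)))\<^sup>2) \<partial>lborel)
     = (\<integral>\<^sup>+t. (\<integral>\<^sup>+j. ennreal ((norm (g (t + of_int j * L - \<alpha> * of_int m)))\<^sup>2) \<partial>count_space (UNIV :: int set)) \<partial>period_measure L)"
    by (rule nn_integral_periodize[OF L]) simp
  also have "\<dots> \<le> (\<integral>\<^sup>+t. ennreal upper_const \<partial>period_measure L)"
    by (intro nn_integral_mono window_square_summable)
  also have "\<dots> < \<infinity>"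
    using finite_measure.emeasure_finite[OF finite_measure_period, of L "{0..<L}"]
    by (simp add: ennreal_mult_less_top less_top)
  finally show ?thesis .
qed

text \<open>Conjugated because \<open>fiber\<close> uses \<open>g\<close> unconjugated while the
  inner product conjugates the atom. \<open>fiber_fun\<close> undoes this: it sums
  \<open>f (t + j L)\<close> times the conjugate of \<open>g (t + j L - \<alpha> m)\<close>.\<close>

definition samples :: "(real \<Rightarrow> complex) \<Rightarrow> real \<Rightarrow> int \<Rightarrow> complex" where
  "samples f t j = cnj (f (t + of_int j * L))"

definition fiber_fun :: "(real \<Rightarrow> complex) \<Rightarrow> int \<Rightarrow> real \<Rightarrow> complex" where
  "fiber_fun f m t = cnj (fiber t (samples f t) m)"

lemma fiber_fun_measurable [measurable]:
  assumes [measurable]: "f \<in> borel_measurable borel"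
  shows "fiber_fun f m \<in> borel_measurable borel"
proof -
  interpret sigma_finite_measure "count_space (UNIV :: int set)" by (rule sigma_finite_count_int)
  have "(\<lambda>(t, j). samples f t j * g (t + of_int j * L - \<alpha> * of_int m)) \<in> borel_measurable (borel \<Otimes>\<^sub>M count_space UNIV)"
    unfolding samples_def case_prod_beta
    by (intro borel_measurable_times measurable_translates[of "\<lambda>x. g (x - \<alpha> * of_int m)"]
         measurable_translates[of "\<lambda>x. cnj (f x)"] borel_measurable_cnj) measurable
  then have "(\<lambda>t. fiber t (samples f t) m) \<in> borel_measurable borel"
    unfolding fiber_def by (rule borel_measurable_lebesgue_integral)
  then show ?thesis unfolding fiber_fun_def[abs_def]
    by (rule borel_measurable_cnj)
qed

lemma samples_energy_measurable:
  assumes [measurable]: "f \<in> borel_measurable borel"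
  shows "(\<lambda>t. \<integral>\<^sup>+j. ennreal ((norm (samples f t j))\<^sup>2) \<partial>count_space UNIV) \<in> borel_measurable (period_measure L)"
proof -
  interpret sigma_finite_measure "count_space (UNIV :: int set)" by (rule sigma_finite_count_int)
  have "(\<lambda>(t, j). ennreal ((norm (samples f t j))\<^sup>2)) \<in> borel_measurable (borel \<Otimes>\<^sub>M count_space UNIV)"
    unfolding samples_def case_prod_beta complex_mod_cnj
    by (rule measurable_translates[of "\<lambda>x. ennreal ((norm (f x))\<^sup>2)"]) measurable
  then have "(\<lambda>t. \<integral>\<^sup>+j. ennreal ((norm (samples f t j))\<^sup>2) \<partial>count_space UNIV) \<in> borel_measurable borel"
    by (rule borel_measurable_nn_integral)
  then show ?thesis by (intro measurable_restrict_space1) simp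
qed

lemma samples_norm:
  assumes f [measurable]: "f \<in> borel_measurable borel"
  shows "(\<integral>\<^sup>+x. ennreal ((norm (f x))\<^sup>2) \<partial>lborel)
      = (\<integral>\<^sup>+t. (\<integral>\<^sup>+j. ennreal ((norm (samples f t j))\<^sup>2) \<partial>count_space UNIV) \<partial>period_measure L)"
  unfolding samples_def by (subst nn_integral_periodize[OF L]) auto

lemma samples_square_summable:
  assumes "f \<in> L2"
  shows "AE t in period_measure L. integrable (count_space UNIV) (\<lambda>j. (norm (samples f t j))\<^sup>2)"
proof -
  have f [measurable]: "f \<in> borel_measurable borel" and f2: "integrable lborel (\<lambda>x. (norm (f x))\<^sup>2)"
    using assms by (auto simp: L2_def)
  have "(\<integral>\<^sup>+t. (\<integral>\<^sup>+j. ennreal ((norm (samples f t j))\<^sup>2) \<partial>count_space UNIV) \<partial>period_measure L) \<noteq> \<infinity>"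
    using f2 unfolding samples_norm[OF f, symmetric] integrable_iff_bounded by simp
  then have "AE t in period_measure L. (\<integral>\<^sup>+j. ennreal ((norm (samples f t j))\<^sup>2) \<partial>count_space UNIV) \<noteq> \<infinity>"
    by (intro nn_integral_PInf_AE samples_energy_measurable f)
  then show ?thesis
  proof eventually_elim
    case (elim t)
    then show ?case by (intro integrableI_nonneg) (auto simp: less_top)
  qed
qed

lemma nn_integral_samples:
  assumes "integrable (count_space UNIV) (\<lambda>j. (norm (samples f t j))\<^sup>2)" "C \<ge> 0"
  shows "ennreal (C * (LINT j|count_space UNIV. (norm (samples f t j))\<^sup>2)) =
     ennreal C * (\<integral>\<^sup>+j. ennreal ((norm (samples f t j))\<^sup>2) \<partial>count_space UNIV)"
  using assms by (simp add: ennreal_mult' nn_integral_eq_integral)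

text \<open>The sample sequence is known to be square-summable only for almost every
  \<open>t\<close>; there the fiber bounds apply with constants independent of
  \<open>t\<close>.\<close>

lemma fiber_energy_bounds:
  assumes "f \<in> L2"
  shows "AE t in period_measure L. (\<integral>\<^sup>+m. ennreal ((norm (fiber_fun f m t))\<^sup>2) \<partial>count_space UNIV)
      \<le> ennreal upper_const * (\<integral>\<^sup>+j. ennreal ((norm (samples f t j))\<^sup>2) \<partial>count_space UNIV)"
    and "\<alpha> \<le> L \<Longrightarrow> AE t in period_measure L.
       ennreal (lower_const / 2) * (\<integral>\<^sup>+j. ennreal ((norm (samples f t j))\<^sup>2) \<partial>count_space UNIV)
     \<le> (\<integral>\<^sup>+m. ennreal ((norm (fiber_fun f m t))\<^sup>2) \<partial>count_space UNIV)"
proof -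
  show "AE t in period_measure L. (\<integral>\<^sup>+m. ennreal ((norm (fiber_fun f m t))\<^sup>2) \<partial>count_space UNIV)
      \<le> ennreal upper_const * (\<integral>\<^sup>+j. ennreal ((norm (samples f t j))\<^sup>2) \<partial>count_space UNIV)"
    using samples_square_summable[OF assms]
  proof eventually_elim
    case (elim t)
    then show ?case
      using fiber_upper[OF elim, of t] nn_integral_samples[OF elim upper_const_nonneg] by (simp add: fiber_fun_def)
  qed
  assume *: "\<alpha> \<le> L"
  show "AE t in period_measure L.
       ennreal (lower_const / 2) * (\<integral>\<^sup>+j. ennreal ((norm (samples f t j))\<^sup>2) \<partial>count_space UNIV)
     \<le> (\<integral>\<^sup>+m. ennreal ((norm (fiber_fun f m t))\<^sup>2) \<partial>count_space UNIV)"
    using samples_square_summable[OF assms]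
  proof eventually_elim
    case (elim t)
    have "lower_const / 2 \<ge> 0" using lower_const_pos by simp
    then show ?case
      using fiber_lower[OF elim *, of t] nn_integral_samples[OF elim, of "lower_const / 2"] by (simp add: fiber_fun_def)
  qed
qed

lemma fiber_fun_square_integrable:
  assumes "f \<in> L2"
  shows "integrable (period_measure L) (\<lambda>t. (norm (fiber_fun f m t))\<^sup>2)"
proof (rule integrableI_nonneg)
  have f [measurable]: "f \<in> borel_measurable borel" and f2: "integrable lborel (\<lambda>x. (norm (f x))\<^sup>2)"
    using assms by (auto simp: L2_def)
  show "(\<lambda>t. (norm (fiber_fun f m t))\<^sup>2) \<in> borel_measurable (period_measure L)"
    by (rule measurable_restrict_space1) simp
  have "(\<integral>\<^sup>+t. ennreal ((norm (fiber_fun f m t))\<^sup>2) \<partial>period_measure L)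
     \<le> (\<integral>\<^sup>+t. ennreal upper_const * (\<integral>\<^sup>+j. ennreal ((norm (samples f t j))\<^sup>2) \<partial>count_space UNIV) \<partial>period_measure L)"
  proof (rule nn_integral_mono_AE)
    show "AE t in period_measure L. ennreal ((norm (fiber_fun f m t))\<^sup>2)
       \<le> ennreal upper_const * (\<integral>\<^sup>+j. ennreal ((norm (samples f t j))\<^sup>2) \<partial>count_space UNIV)"
      using fiber_energy_bounds(1)[OF assms]
    proof eventually_elim
      case (elim t)
      have "ennreal ((norm (fiber_fun f m t))\<^sup>2) \<le> (\<integral>\<^sup>+m. ennreal ((norm (fiber_fun f m t))\<^sup>2) \<partial>count_space UNIV)"
        by (rule nn_integral_ge_point) simp
      then show ?case using elim by (rule order_trans)
    qed
  qed
  also have "\<dots> \<le> ennreal upper_const * (\<integral>\<^sup>+x. ennreal ((norm (f x))\<^sup>2) \<partial>lborel)"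
    unfolding samples_norm[OF f]
    by (subst nn_integral_cmult[OF samples_energy_measurable[OF f]]) simp
  also have "\<dots> < \<infinity>"
    using f2 unfolding integrable_iff_bounded by (simp add: ennreal_mult_less_top)
  finally show "(\<integral>\<^sup>+t. ennreal ((norm (fiber_fun f m t))\<^sup>2) \<partial>period_measure L) < \<infinity>" .
qed simp

text \<open>The modulation of frequency \<open>n/L\<close> has period \<open>L\<close>, so it
  factors out of the sum over translates.\<close>

lemma L2_inner_gabor_atom:
  assumes "f \<in> L2"
  shows "L2_inner f (gabor_atom g \<alpha> (1/L) m n) = fourier_coeff L (fiber_fun f m) n"
proof -
  have f [measurable]: "f \<in> borel_measurable borel" and f2: "integrable lborel (\<lambda>x. (norm (f x))\<^sup>2)"
    using assms by (auto simp: L2_def)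
  have atom: "gabor_atom g \<alpha> (1/L) m n x = harmonic L n x * g (x - \<alpha> * of_int m)" for x
    by (simp add: gabor_atom_def harmonic_def cis_conv_exp mult_ac)
  have shift: "harmonic L n (t + of_int j * L) = harmonic L n t" for t j
  proof -
    have "2 * pi * of_int n * (t + of_int j * L) / L = 2 * pi * of_int n * t / L + 2 * pi * of_int (n * j)"
      using L by (simp add: field_simps)
    then show ?thesis
      unfolding harmonic_def using cis_multiple_2pi[of "of_int (n * j)"] by (simp add: cis_mult[symmetric])
  qed
  have g2: "integrable lborel (\<lambda>x. (norm (cnj (gabor_atom g \<alpha> (1/L) m n x)))\<^sup>2)"
    by (rule integrableI_nonneg)
       (use nn_integral_window in \<open>auto simp: atom norm_mult intro!: borel_measurable_cnj\<close>)
  have cg: "(\<lambda>x. cnj (gabor_atom g \<alpha> (1/L) m n x)) \<in> borel_measurable borel"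
    unfolding atom by (intro borel_measurable_cnj) measurable
  have i: "integrable lborel (\<lambda>x. f x * cnj (gabor_atom g \<alpha> (1/L) m n x))"
    by (rule integrable_norm_sq_mult[OF _ _ f2 g2]) (use cg in auto)
  have "L2_inner f (gabor_atom g \<alpha> (1/L) m n) = (LINT t|period_measure L. LINT j|count_space (UNIV :: int set).
       f (t + of_int j * L) * cnj (gabor_atom g \<alpha> (1/L) m n (t + of_int j * L)))"
    unfolding L2_inner_def by (rule integral_periodize[OF L i])
  also have "\<dots> = (LINT t|period_measure L. fiber_fun f m t * cnj (harmonic L n t))"
  proof (rule Bochner_Integration.integral_cong[OF refl])
    fix t
    have "(LINT j|count_space (UNIV :: int set). f (t + of_int j * L) * cnj (gabor_atom g \<alpha> (1/L) m n (t + of_int j * L)))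
      = (LINT j|count_space (UNIV :: int set). cnj (harmonic L n t) * cnj (samples f t j * g (t + of_int j * L - \<alpha> * of_int m)))"
      unfolding atom shift samples_def by (simp add: mult_ac)
    also have "\<dots> = fiber_fun f m t * cnj (harmonic L n t)"
      by (simp add: fiber_fun_def fiber_def del: complex_cnj_mult)
    finally show "(LINT j|count_space (UNIV :: int set). f (t + of_int j * L) * cnj (gabor_atom g \<alpha> (1/L) m n (t + of_int j * L)))
      = fiber_fun f m t * cnj (harmonic L n t)" .
  qed
  finally show ?thesis by (simp add: fourier_coeff_def)
qed

text \<open>For fixed \<open>m\<close>, Parseval sums over the modulations; Tonelli then exchanges
  the sum over \<open>m\<close> with the integral over \<open>t\<close>. Both frame bounds thereby
  become questions about fibers.\<close>

lemma gabor_energy: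
  assumes "f \<in> L2"
  shows "(\<integral>\<^sup>+p. ennreal (case p of (m, n) \<Rightarrow> (norm (L2_inner f (gabor_atom g \<alpha> (1/L) m n)))\<^sup>2) \<partial>count_space UNIV)
     = ennreal L * (\<integral>\<^sup>+t. (\<integral>\<^sup>+m. ennreal ((norm (fiber_fun f m t))\<^sup>2) \<partial>count_space UNIV) \<partial>period_measure L)"
proof -
  have f [measurable]: "f \<in> borel_measurable borel"
    using assms by (auto simp: L2_def)
  have "(\<integral>\<^sup>+p. ennreal (case p of (m, n) \<Rightarrow> (norm (L2_inner f (gabor_atom g \<alpha> (1/L) m n)))\<^sup>2) \<partial>count_space UNIV)
    = (\<integral>\<^sup>+m. (\<integral>\<^sup>+n. ennreal ((norm (fourier_coeff L (fiber_fun f m) n))\<^sup>2) \<partial>count_space UNIV) \<partial>count_space UNIV)"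
    by (subst nn_integral_fst_count_space[symmetric]) (simp add: L2_inner_gabor_atom[OF assms])
  also have "\<dots> = (\<integral>\<^sup>+m. ennreal L * (\<integral>\<^sup>+t. ennreal ((norm (fiber_fun f m t))\<^sup>2) \<partial>period_measure L) \<partial>count_space UNIV)"
  proof (rule nn_integral_cong)
    fix m
    let ?I = "LINT t|period_measure L. (norm (fiber_fun f m t))\<^sup>2"
    have "((\<lambda>n. (norm (fourier_coeff L (fiber_fun f m) n))\<^sup>2) has_sum L * ?I) UNIV"
      by (rule parseval_period[OF L _ fiber_fun_square_integrable[OF assms]]) simp
    moreover have I0: "?I \<ge> 0" by (rule Bochner_Integration.integral_nonneg) simp
    ultimately have "(\<integral>\<^sup>+n. ennreal ((norm (fourier_coeff L (fiber_fun f m) n))\<^sup>2) \<partial>count_space UNIV) = ennreal (L * ?I)"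
      using L by (intro nn_integral_count_space_has_sum[THEN iffD2]) auto
    also have "\<dots> = ennreal L * ennreal ?I" using L by (simp add: ennreal_mult')
    also have "ennreal ?I = (\<integral>\<^sup>+t. ennreal ((norm (fiber_fun f m t))\<^sup>2) \<partial>period_measure L)"
      by (rule nn_integral_eq_integral[symmetric, OF fiber_fun_square_integrable[OF assms]]) simp
    finally show "(\<integral>\<^sup>+n. ennreal ((norm (fourier_coeff L (fiber_fun f m) n))\<^sup>2) \<partial>count_space UNIV)
       = ennreal L * (\<integral>\<^sup>+t. ennreal ((norm (fiber_fun f m t))\<^sup>2) \<partial>period_measure L)" .
  qed
  also have "\<dots> = ennreal L * (\<integral>\<^sup>+m. (\<integral>\<^sup>+t. ennreal ((norm (fiber_fun f m t))\<^sup>2) \<partial>period_measure L) \<partial>count_space UNIV)"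
    by (rule nn_integral_cmult) simp
  also have "(\<integral>\<^sup>+m. (\<integral>\<^sup>+t. ennreal ((norm (fiber_fun f m t))\<^sup>2) \<partial>period_measure L) \<partial>count_space UNIV)
     = (\<integral>\<^sup>+t. (\<integral>\<^sup>+m. ennreal ((norm (fiber_fun f m t))\<^sup>2) \<partial>count_space UNIV) \<partial>period_measure L)"
    by (rule nn_integral_count_space_nn_integral[symmetric]) (auto intro!: measurable_restrict_space1)
  finally show ?thesis .
qed

end

section \<open>Density\<close>

text \<open>Gaussian elimination by induction on the equations: a nonzero entry of the new row is
  the pivot, its unknown is eliminated from the other rows and recovered afterwards.\<close>

lemma underdetermined_system_nontrivial:
  fixes A :: "'i \<Rightarrow> 'j \<Rightarrow> complex"
  assumes "finite I" "finite J" "card I < card J"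
  shows "\<exists>d. (\<exists>j\<in>J. d j \<noteq> 0) \<and> (\<forall>i\<in>I. (\<Sum>j\<in>J. A i j * d j) = 0)"
  using assms
proof (induction I arbitrary: J A rule: finite_induct)
  case empty
  then have "J \<noteq> {}" by auto
  then show ?case by (intro exI[of _ "\<lambda>_. 1"]) auto
next
  case (insert i0 I)
  show ?case
  proof (cases "\<forall>j\<in>J. A i0 j = 0")
    case True
    obtain d where "\<exists>j\<in>J. d j \<noteq> 0" "\<forall>i\<in>I. (\<Sum>j\<in>J. A i j * d j) = 0"
      using insert.IH[of J A] insert.hyps insert.prems by auto
    then show ?thesis using True by (intro exI[of _ d]) auto
  next
    case False
    then obtain j0 where j0: "j0 \<in> J" "A i0 j0 \<noteq> 0" by blast
    let ?J = "J - {j0}"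
    have "card I < card ?J" using insert j0 by simp
    then obtain d where d: "\<exists>j\<in>?J. d j \<noteq> 0"
      "\<forall>i\<in>I. (\<Sum>j\<in>?J. (A i j - A i j0 * A i0 j / A i0 j0) * d j) = 0"
      using insert.IH[of ?J "\<lambda>i j. A i j - A i j0 * A i0 j / A i0 j0"] insert.prems by auto
    define s where "s = (\<Sum>j\<in>?J. A i0 j * d j)"
    define e where "e = d(j0 := - s / A i0 j0)"
    have sum_e: "(\<Sum>j\<in>J. A i j * e j) = A i j0 * (- s / A i0 j0) + (\<Sum>j\<in>?J. A i j * d j)" for i
      using insert.prems(1) j0(1) by (subst sum.remove[of J j0]) (auto simp: e_def)
    have "(\<Sum>j\<in>J. A i j * e j) = 0" if "i \<in> I" for i
    proof -
      have eq: "(A i j - A i j0 * A i0 j / A i0 j0) * d j = A i j * d j - A i j0 / A i0 j0 * (A i0 j * d j)" for j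
        by (simp add: left_diff_distrib)
      have "0 = (\<Sum>j\<in>?J. A i j * d j - A i j0 / A i0 j0 * (A i0 j * d j))"
        using bspec[OF d(2) that] unfolding eq by (rule sym)
      also have "\<dots> = (\<Sum>j\<in>?J. A i j * d j) - A i j0 / A i0 j0 * s"
        by (simp add: s_def sum_subtractf sum_distrib_left)
      finally show ?thesis unfolding sum_e by simp
    qed
    moreover have "(\<Sum>j\<in>J. A i0 j * e j) = 0"
      unfolding sum_e using j0 by (simp add: s_def)
    moreover have "\<exists>j\<in>J. e j \<noteq> 0" using d(1) by (auto simp: e_def)
    ultimately show ?thesis by (intro exI[of _ e]) auto
  qed
qed

text \<open>The sum is a Taylor polynomial in \<open>x\<close> of \<open>- 1 / (x - z)\<close>, so
  up to sign the left side is the remainder.\<close>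

lemma geometric_remainder:
  fixes x z :: complex
  assumes "z \<noteq> 0" "x \<noteq> z"
  shows "1 / (x - z) + (\<Sum>q<p. x ^ q / z ^ Suc q) = (x / z) ^ p / (x - z)"
proof (induction p)
  case (Suc p)
  have "(x / z) ^ p / (x - z) + x ^ p / z ^ Suc p = (x / z) ^ p * (1 / (x - z) + 1 / z)"
    by (simp add: power_divide ring_distribs)
  also have "1 / (x - z) + 1 / z = x / z / (x - z)"
    using assms by (simp add: field_simps)
  finally show ?case using Suc.IH by (simp add: add.assoc[symmetric] mult.commute)
qed simp

text \<open>Adding the first \<open>p\<close> Taylor terms changes nothing, since each is a
  vanishing moment times a factor independent of \<open>j\<close>. Only the remainder is left, of
  order \<open>(R / \<rho>) ^ p\<close> because the nodes stay within radius \<open>R\<close> and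
  the pole outside radius \<open>\<rho>\<close>.\<close>

lemma vanishing_moments_bound:
  fixes d :: "int \<Rightarrow> complex"
  assumes moments: "\<And>q. q < p \<Longrightarrow> (\<Sum>j\<in>J. of_int j ^ q * d j) = 0"
    and J: "\<And>j. j \<in> J \<Longrightarrow> \<bar>of_int j * L\<bar> \<le> R"
    and R: "0 \<le> R" "R < \<rho>" and z: "\<rho> \<le> norm z"
  shows "norm (\<Sum>j\<in>J. d j / (of_real (of_int j * L) - z)) \<le> (\<Sum>j\<in>J. norm (d j)) * ((R / \<rho>) ^ p / (\<rho> - R))"
proof -
  let ?x = "\<lambda>j. of_real (of_int j * L) :: complex"
  have z0: "z \<noteq> 0" using R z by auto
  have nx: "norm (?x j) \<le> R" if "j \<in> J" for j using J[OF that] by (simp only: norm_of_real)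
  have dist: "\<rho> - R \<le> norm (?x j - z)" if "j \<in> J" for j
    using nx[OF that] z norm_triangle_ineq2[of z "?x j"] by (simp add: norm_minus_commute)
  have xz: "?x j \<noteq> z" if "j \<in> J" for j using dist[OF that] R by auto
  have "(\<Sum>j\<in>J. d j * (\<Sum>q<p. ?x j ^ q / z ^ Suc q)) = (\<Sum>q<p. of_real L ^ q / z ^ Suc q * (\<Sum>j\<in>J. of_int j ^ q * d j))"
    unfolding sum_distrib_left
    by (subst sum.swap) (intro sum.cong refl, simp add: power_mult_distrib mult_ac)
  also have "\<dots> = 0" by (simp add: moments)
  finally have "(\<Sum>j\<in>J. d j / (?x j - z)) = (\<Sum>j\<in>J. d j * (1 / (?x j - z) + (\<Sum>q<p. ?x j ^ q / z ^ Suc q)))"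
    by (simp add: ring_distribs sum.distrib)
  also have "\<dots> = (\<Sum>j\<in>J. d j * ((?x j / z) ^ p / (?x j - z)))"
    using geometric_remainder[OF z0 xz] by (intro sum.cong refl) metis
  also have "norm \<dots> \<le> (\<Sum>j\<in>J. norm (d j) * ((R / \<rho>) ^ p / (\<rho> - R)))"
  proof (rule sum_norm_le)
    fix j assume j: "j \<in> J"
    have "norm ((?x j / z) ^ p / (?x j - z)) = (norm (?x j) / norm z) ^ p / norm (?x j - z)"
      by (simp add: norm_divide norm_power)
    also have "\<dots> \<le> (R / \<rho>) ^ p / (\<rho> - R)"
      using R z nx[OF j] dist[OF j] by (intro frac_le power_mono) auto
    finally show "norm (d j * ((?x j / z) ^ p / (?x j - z))) \<le> norm (d j) * ((R / \<rho>) ^ p / (\<rho> - R))"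
      unfolding norm_mult by (rule mult_left_mono) simp
  qed
  finally show ?thesis by (simp only: sum_distrib_right)
qed

text \<open>At \<open>m = 0\<close> the term is \<open>1 / 0 = 0\<close>, so all integers may be
  included.\<close>

lemma inverse_squares_int:
  "(\<integral>\<^sup>+m. ennreal (1 / (of_int m)\<^sup>2) \<partial>count_space (UNIV :: int set)) < \<infinity>"
proof -
  let ?f = "\<lambda>m :: int. 1 / (real_of_int m)\<^sup>2"
  have "summable (\<lambda>n. inverse (real n ^ 2))" by (rule inverse_power_summable) simp
  then have "(\<lambda>n :: nat. 1 / (real n)\<^sup>2) summable_on UNIV"
    by (intro norm_summable_imp_summable_on) (simp add: inverse_eq_divide)
  then have 1: "?f summable_on range int"
    by (subst summable_on_reindex) (auto simp: o_def)
  then have 2: "?f summable_on uminus ` range int"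
    by (subst summable_on_reindex) (auto simp: o_def inj_on_def)
  have "UNIV = range int \<union> uminus ` range int"
    by (auto simp: image_image) (metis int_cases rangeI)
  then have "?f summable_on UNIV"
    using summable_on_union[OF 1 2] by simp
  then have "(\<integral>\<^sup>+m. ennreal (?f m) \<partial>count_space UNIV) = ennreal (infsum ?f UNIV)"
    by (intro nn_integral_count_space_has_sum[THEN iffD2]) (auto intro!: infsum_nonneg)
  then show ?thesis by simp
qed

section \<open>Frame bounds up to the critical density\<close>

context herglotz_window
begin

lemma gabor_energy_bounds:
  assumes f: "f \<in> L2"
  shows "(\<integral>\<^sup>+p. ennreal (case p of (m, n) \<Rightarrow> (norm (L2_inner f (gabor_atom g \<alpha> (1/L) m n)))\<^sup>2) \<partial>count_space UNIV)
      \<le> ennreal (L * upper_const * L2_norm_sq f)"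
    and "\<alpha> \<le> L \<Longrightarrow> ennreal (L * (lower_const / 2) * L2_norm_sq f) \<le>
      (\<integral>\<^sup>+p. ennreal (case p of (m, n) \<Rightarrow> (norm (L2_inner f (gabor_atom g \<alpha> (1/L) m n)))\<^sup>2) \<partial>count_space UNIV)"
proof -
  have fm: "f \<in> borel_measurable borel" and f2: "integrable lborel (\<lambda>x. (norm (f x))\<^sup>2)"
    using f by (auto simp: L2_def)
  let ?S = "\<lambda>t. \<integral>\<^sup>+j. ennreal ((norm (samples f t j))\<^sup>2) \<partial>count_space UNIV"
  have norm_f: "(\<integral>\<^sup>+t. ?S t \<partial>period_measure L) = ennreal (L2_norm_sq f)"
    unfolding samples_norm[OF fm, symmetric] L2_norm_sq_def by (rule nn_integral_eq_integral[OF f2]) simp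
  have scale: "ennreal L * (\<integral>\<^sup>+t. ennreal C * ?S t \<partial>period_measure L) = ennreal (L * C * L2_norm_sq f)"
    if "C \<ge> 0" for C
    using that L by (subst nn_integral_cmult[OF samples_energy_measurable[OF fm]])
      (simp add: norm_f ennreal_mult' mult.assoc)
  have "ennreal L * (\<integral>\<^sup>+t. (\<integral>\<^sup>+m. ennreal ((norm (fiber_fun f m t))\<^sup>2) \<partial>count_space UNIV) \<partial>period_measure L)
     \<le> ennreal L * (\<integral>\<^sup>+t. ennreal upper_const * ?S t \<partial>period_measure L)"
    by (intro mult_left_mono nn_integral_mono_AE fiber_energy_bounds(1)[OF f]) simp
  then show "(\<integral>\<^sup>+p. ennreal (case p of (m, n) \<Rightarrow> (norm (L2_inner f (gabor_atom g \<alpha> (1/L) m n)))\<^sup>2) \<partial>count_space UNIV)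
      \<le> ennreal (L * upper_const * L2_norm_sq f)"
    unfolding gabor_energy[OF f] scale[OF upper_const_nonneg] .
  assume "\<alpha> \<le> L"
  then have "ennreal L * (\<integral>\<^sup>+t. ennreal (lower_const / 2) * ?S t \<partial>period_measure L)
      \<le> ennreal L * (\<integral>\<^sup>+t. (\<integral>\<^sup>+m. ennreal ((norm (fiber_fun f m t))\<^sup>2) \<partial>count_space UNIV) \<partial>period_measure L)"
    by (intro mult_left_mono nn_integral_mono_AE fiber_energy_bounds(2)[OF f]) simp_all
  moreover have "lower_const / 2 \<ge> 0" using lower_const_pos by simp
  ultimately show "ennreal (L * (lower_const / 2) * L2_norm_sq f) \<le>
      (\<integral>\<^sup>+p. ennreal (case p of (m, n) \<Rightarrow> (norm (L2_inner f (gabor_atom g \<alpha> (1/L) m n)))\<^sup>2) \<partial>count_space UNIV)"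
    unfolding gabor_energy[OF f] scale[OF \<open>lower_const / 2 \<ge> 0\<close>] by simp
qed

theorem gabor_frame_if_dense:
  assumes density: "\<alpha> \<le> L"
  shows "gabor_frame g \<alpha> (1/L)"
proof -
  define A where "A = L * (lower_const / 2)"
  \<comment> \<open>The maximum secures \<open>A \<le> B\<close> without comparing the two fiber
    constants.\<close>
  define B where "B = max A (L * upper_const)"
  have A: "A > 0" unfolding A_def using L lower_const_pos by simp
  show ?thesis
    unfolding gabor_frame_def
  proof (intro exI conjI ballI)
    show "0 < A" by (rule A)
    show "A \<le> B" by (simp add: B_def)
    fix f assume f: "f \<in> L2"
    let ?h = "\<lambda>(m, n). (norm (L2_inner f (gabor_atom g \<alpha> (1/L) m n)))\<^sup>2"
    have n0: "L2_norm_sq f \<ge> 0" unfolding L2_norm_sq_def by (rule Bochner_Integration.integral_nonneg) simp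
    have up: "(\<integral>\<^sup>+p. ennreal (?h p) \<partial>count_space UNIV) \<le> ennreal (L * upper_const * L2_norm_sq f)"
      by (rule gabor_energy_bounds(1)[OF f])
    then obtain e where e: "e \<ge> 0" "(\<integral>\<^sup>+p. ennreal (?h p) \<partial>count_space UNIV) = ennreal e"
      by (cases "\<integral>\<^sup>+p. ennreal (?h p) \<partial>count_space UNIV") (auto simp: top_unique)
    have hs: "(?h has_sum e) UNIV"
      by (rule nn_integral_count_space_has_sum[THEN iffD1]) (use e in \<open>auto simp: case_prod_beta\<close>)
    then show "?h summable_on UNIV" by (simp add: has_sum_iff)
    have inf: "infsum ?h UNIV = e" using hs by (simp add: has_sum_iff)
    have "ennreal (A * L2_norm_sq f) \<le> ennreal e"
      using gabor_energy_bounds(2)[OF f density] unfolding e(2) A_def .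
    then show "A * L2_norm_sq f \<le> infsum ?h UNIV"
      unfolding inf using e(1) by (simp add: ennreal_le_iff)
    have "e \<le> L * upper_const * L2_norm_sq f"
      using up unfolding e(2) using L upper_const_nonneg n0 by (subst (asm) ennreal_le_iff) auto
    also have "\<dots> \<le> B * L2_norm_sq f" using n0 by (intro mult_right_mono) (auto simp: B_def)
    finally show "infsum ?h UNIV \<le> B * L2_norm_sq f" unfolding inf .
  qed
qed

section \<open>Failure of the lower bound beyond the critical density\<close>

lemma continuous_window [continuous_intros]: "continuous_on S g"
proof -
  have "g = (\<lambda>t. \<Sum>k=1..N. of_real (a k) / (of_real t - \<i> * of_real (w k)))" using g by (rule ext)
  moreover have "of_real t - \<i> * of_real (w k) \<noteq> 0" if "k \<in> {1..N}" for t k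
    using w[OF that] by (auto simp: complex_eq_iff)
  ultimately show ?thesis by (auto intro!: continuous_intros simp del: One_nat_def)
qed

text \<open>As a function of the node \<open>j L\<close>, the \<open>k\<close>-th summand has its
  pole at \<open>\<alpha> m - t + i w k\<close>, of modulus at least \<open>\<alpha> |m| - L\<close>
  because \<open>0 \<le> t < L\<close>. The bound is uniform in such \<open>t\<close>.\<close>

lemma fiber_value_tail:
  assumes moments: "\<And>q. q < p \<Longrightarrow> (\<Sum>j\<in>J. of_int j ^ q * d j) = 0"
    and J: "\<And>j. j \<in> J \<Longrightarrow> \<bar>of_int j * L\<bar> \<le> R"
    and R: "0 \<le> R" "R < \<rho>" and t: "t \<in> {0..<L}" and \<rho>: "\<rho> = \<alpha> * \<bar>of_int m\<bar> - L"
  shows "norm (fiber_value t d J m) \<le> (\<Sum>k=1..N. a k) * ((\<Sum>j\<in>J. norm (d j)) * ((R / \<rho>) ^ p / (\<rho> - R)))"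
proof -
  let ?z = "\<lambda>k. of_real (\<alpha> * of_int m - t) + \<i> * of_real (w k) :: complex"
  have z: "\<rho> \<le> norm (?z k)" for k
  proof -
    have "\<rho> \<le> \<bar>Re (?z k)\<bar>"
      using t \<alpha> unfolding \<rho> by (cases "m \<ge> 0") (auto simp: abs_if algebra_simps)
    then show ?thesis using abs_Re_le_cmod order_trans by blast
  qed
  have "fiber_value t d J m = (\<Sum>k=1..N. of_real (a k) * (\<Sum>j\<in>J. d j / (of_real (of_int j * L) - ?z k)))"
    unfolding fiber_value_def g sum_distrib_left
    by (subst sum.swap) (intro sum.cong refl, simp add: algebra_simps)
  also have "norm \<dots> \<le> (\<Sum>k=1..N. a k * ((\<Sum>j\<in>J. norm (d j)) * ((R / \<rho>) ^ p / (\<rho> - R))))"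
  proof (rule sum_norm_le)
    fix k assume k: "k \<in> {1..N}"
    from mult_left_mono[OF vanishing_moments_bound[OF moments J R z], where c = "a k"]
    show "norm (of_real (a k) * (\<Sum>j\<in>J. d j / (of_real (of_int j * L) - ?z k)))
       \<le> a k * ((\<Sum>j\<in>J. norm (d j)) * ((R / \<rho>) ^ p / (\<rho> - R)))"
      using a[OF k] by (simp add: norm_mult)
  qed
  finally show ?thesis by (simp only: sum_distrib_right)
qed

text \<open>Turns a bad coefficient vector into a bad function: \<open>f\<close> takes the value
  \<open>cnj (d j)\<close> on the interval from \<open>j L\<close> to \<open>j L + \<eta>\<close>.
  As \<open>\<eta> \<le> L\<close> these intervals are disjoint, and the samples of \<open>f\<close>
  are \<open>d\<close> for \<open>t < \<eta>\<close> and zero for the other \<open>t\<close> in the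
  period.\<close>

lemma step_function_energy:
  fixes d :: "int \<Rightarrow> complex"
  assumes J: "finite J" and \<eta>: "0 < \<eta>" "\<eta> \<le> L"
    and small: "\<And>t. t \<in> {0..<\<eta>} \<Longrightarrow>
      (\<integral>\<^sup>+m. ennreal ((norm (fiber_value t d J m))\<^sup>2) \<partial>count_space UNIV) \<le> ennreal (C * (\<Sum>j\<in>J. (norm (d j))\<^sup>2))"
    and C: "C \<ge> 0"
  obtains f where "f \<in> L2" "L2_norm_sq f = \<eta> * (\<Sum>j\<in>J. (norm (d j))\<^sup>2)"
    "(\<integral>\<^sup>+p. ennreal (case p of (m, n) \<Rightarrow> (norm (L2_inner f (gabor_atom g \<alpha> (1/L) m n)))\<^sup>2) \<partial>count_space UNIV)
       \<le> ennreal (L * C * L2_norm_sq f)"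
proof -
  let ?S = "\<Sum>j\<in>J. (norm (d j))\<^sup>2"
  have S0: "?S \<ge> 0" by (simp add: sum_nonneg)
  define f where "f x = (\<Sum>j\<in>J. cnj (d j) * indicator {of_int j * L..<of_int j * L + \<eta>} x)" for x
  have fm [measurable]: "f \<in> borel_measurable borel" unfolding f_def by measurable
  have smp: "samples f t j = (if j \<in> J \<and> t < \<eta> then d j else 0)" if t: "t \<in> {0..<L}" for t j
  proof -
    have mem: "t + of_int j * L \<in> {of_int i * L..<of_int i * L + \<eta>} \<longleftrightarrow> i = j \<and> t < \<eta>" for i
    proof
      assume *: "t + of_int j * L \<in> {of_int i * L..<of_int i * L + \<eta>}"
      have "(real_of_int i - of_int j - 1) * L < 0 * L" using * t by (simp add: algebra_simps)
      moreover have "(real_of_int j - of_int i - 1) * L < 0 * L" using * t \<eta> by (simp add: algebra_simps)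
      ultimately have "real_of_int i - of_int j < 1" "real_of_int j - of_int i < 1"
        using L by (auto simp only: mult_less_cancel_right_pos)
      then have "i = j" by linarith
      then show "i = j \<and> t < \<eta>" using * by simp
    qed (use t in auto)
    have "f (t + of_int j * L) = (\<Sum>i\<in>J. if i = j then (if t < \<eta> then cnj (d j) else 0) else 0)"
      unfolding f_def by (intro sum.cong refl) (use mem in \<open>auto simp: indicator_def\<close>)
    then show ?thesis using J by (simp add: samples_def)
  qed
  have energy_smp: "(\<integral>\<^sup>+j. ennreal ((norm (samples f t j))\<^sup>2) \<partial>count_space UNIV) = ennreal ?S * indicator {0..<\<eta>} t"
    if t: "t \<in> {0..<L}" for t
  proof -
    have "(\<integral>\<^sup>+j. ennreal ((norm (samples f t j))\<^sup>2) \<partial>count_space UNIV) = (\<Sum>j\<in>J. ennreal ((norm (samples f t j))\<^sup>2))"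
      using J by (intro nn_integral_count_space') (auto simp: smp[OF t])
    also have "\<dots> = ennreal ?S * indicator {0..<\<eta>} t"
      using t by (auto simp: smp[OF t] indicator_def)
    finally show ?thesis .
  qed
  have ind: "(\<integral>\<^sup>+t. ennreal K * indicator {0..<\<eta>} t \<partial>period_measure L) = ennreal (K * \<eta>)" if "K \<ge> 0" for K
  proof -
    have "(\<integral>\<^sup>+t. ennreal K * indicator {0..<\<eta>} t \<partial>period_measure L) = (\<integral>\<^sup>+t. ennreal K * indicator {0..<\<eta>} t \<partial>lborel)"
      using \<eta> by (subst nn_integral_restrict_space) (auto intro!: nn_integral_cong simp: indicator_def)
    also have "\<dots> = ennreal K * ennreal \<eta>"
      using \<eta> by (subst nn_integral_cmult_indicator) auto
    finally show ?thesis using that by (simp add: ennreal_mult')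
  qed
  have norm_f: "(\<integral>\<^sup>+x. ennreal ((norm (f x))\<^sup>2) \<partial>lborel) = ennreal (\<eta> * ?S)"
    unfolding samples_norm[OF fm] using ind[OF S0]
    by (subst nn_integral_cong[of _ _ "\<lambda>t. ennreal ?S * indicator {0..<\<eta>} t"]) (simp_all add: energy_smp mult.commute)
  have f2: "integrable lborel (\<lambda>x. (norm (f x))\<^sup>2)"
    by (rule integrableI_nonneg) (auto simp: norm_f)
  have f: "f \<in> L2" unfolding L2_def using f2 by simp
  have nf: "L2_norm_sq f = \<eta> * ?S"
    unfolding L2_norm_sq_def using \<eta> S0 by (subst integral_eq_nn_integral) (auto simp: norm_f)
  have fib: "fiber_fun f m t = (if t < \<eta> then cnj (fiber_value t d J m) else 0)" if t: "t \<in> {0..<L}" for m t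
  proof -
    have "fiber t (samples f t) m = (LINT j|count_space UNIV. (if j \<in> J then (if t < \<eta> then d j * g (t + of_int j * L - \<alpha> * of_int m) else 0) else 0))"
      unfolding fiber_def by (rule Bochner_Integration.integral_cong) (auto simp: smp[OF t])
    also have "\<dots> = (\<Sum>j\<in>J. if t < \<eta> then d j * g (t + of_int j * L - \<alpha> * of_int m) else 0)"
      by (rule integral_count_space_finite_sum[OF J])
    finally show ?thesis by (simp add: fiber_fun_def fiber_value_def)
  qed
  have "(\<integral>\<^sup>+t. (\<integral>\<^sup>+m. ennreal ((norm (fiber_fun f m t))\<^sup>2) \<partial>count_space UNIV) \<partial>period_measure L)
     \<le> (\<integral>\<^sup>+t. ennreal (C * ?S) * indicator {0..<\<eta>} t \<partial>period_measure L)"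
  proof (rule nn_integral_mono)
    fix t assume "t \<in> space (period_measure L)"
    then have t: "t \<in> {0..<L}" by simp
    show "(\<integral>\<^sup>+m. ennreal ((norm (fiber_fun f m t))\<^sup>2) \<partial>count_space UNIV) \<le> ennreal (C * ?S) * indicator {0..<\<eta>} t"
      using t small[of t] by (cases "t < \<eta>") (auto simp: fib[OF t])
  qed
  also have "\<dots> = ennreal (C * L2_norm_sq f)"
    using ind[of "C * ?S"] C S0 by (simp add: nf mult_ac)
  finally have "ennreal L * (\<integral>\<^sup>+t. (\<integral>\<^sup>+m. ennreal ((norm (fiber_fun f m t))\<^sup>2) \<partial>count_space UNIV) \<partial>period_measure L)
     \<le> ennreal L * ennreal (C * L2_norm_sq f)"
    by (rule mult_left_mono) simp
  then have "ennreal L * (\<integral>\<^sup>+t. (\<integral>\<^sup>+m. ennreal ((norm (fiber_fun f m t))\<^sup>2) \<partial>count_space UNIV) \<partial>period_measure L)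
     \<le> ennreal (L * C * L2_norm_sq f)"
    using L by (simp add: ennreal_mult' mult.assoc)
  then show ?thesis using that[OF f nf] unfolding gabor_energy[OF f] by blast
qed

text \<open>Two sets of equations are imposed on \<open>d\<close>:
  \<open>fiber_value 0 d J m = 0\<close> for \<open>|m| \<le> M\<close>, and \<open>p\<close>
  vanishing moments for the larger \<open>|m|\<close>. The support grows linearly in
  \<open>p\<close>, which the geometric decay of the tail beats.\<close>

lemma small_fiber_energy:
  assumes sparse: "L < \<alpha>" and \<delta>: "\<delta> > 0"
  obtains J d \<eta> where "finite J" "0 < (\<Sum>j\<in>J. (norm (d j))\<^sup>2)" "0 < \<eta>" "\<eta> \<le> L"
    "\<And>t. t \<in> {0..<\<eta>} \<Longrightarrow>
      (\<integral>\<^sup>+m. ennreal ((norm (fiber_value t d J m))\<^sup>2) \<partial>count_space UNIV) \<le> ennreal (\<delta> * (\<Sum>j\<in>J. (norm (d j))\<^sup>2))"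
proof -
  define q where "q = L / \<alpha>"
  \<comment> \<open>Outside the window \<open>|m| \<le> M \<approx> n \<mu>\<close> the ratio of node to pole distance is at most \<open>\<theta> = q / \<mu>\<close>,
    and \<open>\<mu> < 1\<close> leaves room in \<open>2n + 1\<close> unknowns for \<open>p\<close> moment conditions.\<close>
  define \<theta> where "\<theta> = 2 * q / (1 + q)"
  define \<mu> where "\<mu> = (1 + q) / 2"
  have q: "0 < q" "q < 1" using sparse L \<alpha> by (auto simp: q_def)
  have Lq: "L = \<alpha> * q" using \<alpha> by (simp add: q_def)
  have \<theta>: "0 < \<theta>" "\<theta> < 1" using q by (auto simp: \<theta>_def field_simps)
  have \<mu>: "q \<le> \<mu>" "\<mu> < 1" "\<mu> > 0" using q by (auto simp: \<mu>_def)
  have \<theta>\<mu>: "\<theta> * \<mu> = q" using q by (simp add: \<theta>_def \<mu>_def)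
  define sa where "sa = (\<Sum>k=1..N. a k)"
  have sa0: "sa \<ge> 0" unfolding sa_def by (intro sum_nonneg) (use a less_imp_le in blast)
  obtain Z where Z: "Z \<ge> 0" "(\<integral>\<^sup>+m. ennreal (1 / (of_int m)\<^sup>2) \<partial>count_space (UNIV :: int set)) = ennreal Z"
    using inverse_squares_int by (cases "\<integral>\<^sup>+m. ennreal (1 / (of_int m)\<^sup>2) \<partial>count_space (UNIV :: int set)") auto
  \<comment> \<open>The 6 comes from the count. As \<open>M \<le> n \<mu> + 2\<close>, there are at
    most \<open>2 n \<mu> + 5 + p\<close> equations for \<open>2 n + 1\<close> unknowns; with
    \<open>n = K p\<close> the choice gives \<open>2 n (1 - \<mu>) \<ge> 6 p\<close>, which exceeds
    \<open>4 + p\<close> once \<open>p \<ge> 1\<close>.\<close>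
  obtain K :: nat where K: "6 / (1 - q) \<le> real K" using real_arch_simple by blast
  then have K6: "6 \<le> real K * (1 - q)" using q by (simp add: divide_le_eq)
  \<comment> \<open>Prefactor of the tail: \<open>\<theta> ^ p\<close>, squared, from the moments,
    and the number \<open>2 K p + 1\<close> of nodes from replacing the l1 norm of \<open>d\<close>
    by its l2 norm. The factor \<open>2 * Z\<close> below accounts for both tails.\<close>
  define C where "C p = sa\<^sup>2 / \<alpha>\<^sup>2 * (\<theta> ^ p)\<^sup>2 * (2 * real (K * p) + 1)" for p
  have C0: "C p \<ge> 0" for p unfolding C_def by simp
  have \<theta>2: "norm (\<theta>\<^sup>2) < 1" using \<theta> by (simp add: abs_square_less_1)
  have "(\<lambda>p. real p * (\<theta>\<^sup>2) ^ p) \<longlonglongrightarrow> 0"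
    using powser_times_n_limit_0[OF \<theta>2] by simp
  moreover have "(\<lambda>p. (\<theta>\<^sup>2) ^ p) \<longlonglongrightarrow> 0"
    using LIMSEQ_power_zero[OF \<theta>2] by simp
  ultimately have "(\<lambda>p. sa\<^sup>2 / \<alpha>\<^sup>2 * (2 * real K * (real p * (\<theta>\<^sup>2) ^ p) + (\<theta>\<^sup>2) ^ p) * (2 * Z)) \<longlonglongrightarrow> sa\<^sup>2 / \<alpha>\<^sup>2 * (2 * real K * 0 + 0) * (2 * Z)"
    by (intro tendsto_intros \<theta>2)
  moreover have "sa\<^sup>2 / \<alpha>\<^sup>2 * (2 * real K * (real p * (\<theta>\<^sup>2) ^ p) + (\<theta>\<^sup>2) ^ p) * (2 * Z) = C p * (2 * Z)" for p
    unfolding C_def by (simp add: power_mult[symmetric] mult.commute algebra_simps add_divide_distrib)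
  ultimately have "(\<lambda>p. C p * (2 * Z)) \<longlonglongrightarrow> 0" by simp
  then have "\<forall>\<^sub>F p in sequentially. C p * (2 * Z) < \<delta> / 2"
    by (rule order_tendstoD) (use \<delta> in simp)
  then have "\<forall>\<^sub>F p in sequentially. C p * (2 * Z) < \<delta> / 2 \<and> 1 \<le> p"
    using eventually_ge_at_top by (rule eventually_conj)
  then obtain p where p: "C p * (2 * Z) < \<delta> / 2" "1 \<le> p"
    using eventually_happens'[OF sequentially_bot] by blast
  define n where "n = K * p"
  define J where "J = {- int n..int n}"
  \<comment> \<open>The extra \<open>q\<close> compensates the loss \<open>L = \<alpha> * q\<close>
    in the lower bound \<open>\<alpha> |m| - L\<close> for the modulus of the poles.\<close>
  define M where "M = \<lceil>real n * \<mu> + q\<rceil>"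
  have M: "real n * \<mu> + q \<le> of_int M" "of_int M \<le> real n * \<mu> + 2"
    using q unfolding M_def by linarith+
  have M0: "M \<ge> 0"
  proof -
    have "0 \<le> real n * \<mu> + q" using \<mu> q by simp
    then show ?thesis using M(1) by linarith
  qed
  have cardJ: "card J = 2 * n + 1" and finJ: "finite J" by (auto simp: J_def)
  define I where "I = Inl ` {- M..M} \<union> Inr ` {..<p}"
  have "card I = card {- M..M} + p"
    unfolding I_def by (subst card_Un_disjoint) (auto simp: card_image inj_on_def)
  then have cardI: "card I = nat (2 * M + 1) + p" by simp
  have "2 * of_int M + 1 + real p < 2 * real n + 1"
  proof -
    have "6 * real p \<le> real K * (1 - q) * real p" using K6 by (rule mult_right_mono) simp
    also have "1 - q = 2 * (1 - \<mu>)" by (simp add: \<mu>_def field_simps)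
    also have "real K * (2 * (1 - \<mu>)) * real p = 2 * real n * (1 - \<mu>)" by (simp add: n_def)
    finally have "6 * real p + 2 * real n * \<mu> \<le> 2 * real n" by (simp add: algebra_simps)
    moreover have "1 \<le> real p" using p(2) by simp
    ultimately show ?thesis using M(2) by linarith
  qed
  then have "card I < card J" using M0 unfolding cardI cardJ by linarith
  then obtain d where d: "\<exists>j\<in>J. d j \<noteq> 0"
    "\<forall>i\<in>I. (\<Sum>j\<in>J. (case i of Inl m \<Rightarrow> g (of_int j * L - \<alpha> * of_int m) | Inr r \<Rightarrow> of_int j ^ r) * d j) = 0"
    using underdetermined_system_nontrivial[of I J
        "\<lambda>i j. case i of Inl m \<Rightarrow> g (of_int j * L - \<alpha> * of_int m) | Inr r \<Rightarrow> of_int j ^ r"] finJ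
    by (auto simp: I_def)
  have moments: "(\<Sum>j\<in>J. of_int j ^ r * d j) = 0" if "r < p" for r
    using d(2)[rule_format, of "Inr r"] that by (simp add: I_def)
  have kill: "fiber_value 0 d J m = 0" if "m \<in> {- M..M}" for m
    using d(2)[rule_format, of "Inl m"] that by (simp add: I_def fiber_value_def mult.commute)
  define S where "S = (\<Sum>j\<in>J. (norm (d j))\<^sup>2)"
  have S: "S > 0" unfolding S_def using d(1) finJ
    by (auto intro!: sum_pos2 simp: zero_less_power2)
  have tail: "(norm (fiber_value t d J m))\<^sup>2 \<le> C p * S * (1 / (of_int (\<bar>m\<bar> - M))\<^sup>2)"
    if t: "t \<in> {0..<L}" and m: "M < \<bar>m\<bar>" for t m
  proof -
    let ?R = "real n * L" and ?\<rho> = "\<alpha> * \<bar>of_int m\<bar> - L"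
    define r where "r = real_of_int (\<bar>m\<bar> - M)"
    have r: "r \<ge> 1" using m by (simp add: r_def)
    have mr: "\<bar>real_of_int m\<bar> = of_int M + r" by (simp add: r_def)
    have n\<mu>: "real n * q \<le> real n * \<mu>" using \<mu> by (simp add: mult_left_mono)
    \<comment> \<open>\<open>\<rho>1\<close> yields the ratio \<theta>; \<open>\<rho>2\<close>
      yields a gap growing linearly in \<open>r\<close>, hence the summable decay
      \<open>1 / r\<^sup>2\<close>.\<close>
    have "\<alpha> * (real n * \<mu> + q) \<le> \<alpha> * (of_int M + r)"
      using M r \<alpha> by (intro mult_left_mono) auto
    then have \<rho>1: "\<alpha> * (real n * \<mu>) \<le> ?\<rho>" unfolding mr Lq by (simp add: ring_distribs)
    have "\<alpha> * (real n * q + q + r) \<le> \<alpha> * (of_int M + r)"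
      using M n\<mu> \<alpha> by (intro mult_left_mono) auto
    then have \<rho>2: "\<alpha> * r \<le> ?\<rho> - ?R" unfolding mr Lq by (simp add: algebra_simps)
    have \<alpha>r: "\<alpha> * r > 0" using \<alpha> r by simp
    have R0: "?R \<ge> 0" using L by simp
    have \<rho>R: "?R < ?\<rho>" using \<rho>2 \<alpha>r by linarith
    have ratio: "?R / ?\<rho> \<le> \<theta>"
    proof -
      have "?R = \<theta> * (\<alpha> * (real n * \<mu>))" using \<theta>\<mu> unfolding Lq by (simp add: mult_ac)
      also have "\<dots> \<le> \<theta> * ?\<rho>" using \<rho>1 \<theta> by (intro mult_left_mono) auto
      finally show ?thesis using \<rho>R R0 by (subst divide_le_eq) auto
    qed
    have Jb: "\<bar>of_int j * L\<bar> \<le> ?R" if "j \<in> J" for j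
    proof -
      have "\<bar>real_of_int j\<bar> \<le> real n" using that by (auto simp: J_def)
      then show ?thesis using L by (simp add: abs_mult mult_right_mono)
    qed
    have "norm (fiber_value t d J m) \<le> sa * ((\<Sum>j\<in>J. norm (d j)) * ((?R / ?\<rho>) ^ p / (?\<rho> - ?R)))"
      unfolding sa_def by (rule fiber_value_tail[OF moments Jb R0 \<rho>R t refl])
    also have "\<dots> \<le> sa * ((\<Sum>j\<in>J. norm (d j)) * (\<theta> ^ p / (\<alpha> * r)))"
      using sa0 ratio \<rho>2 \<alpha>r R0 \<rho>R \<theta>
      by (intro mult_left_mono frac_le power_mono sum_nonneg) auto
    finally have "(norm (fiber_value t d J m))\<^sup>2 \<le> (sa * ((\<Sum>j\<in>J. norm (d j)) * (\<theta> ^ p / (\<alpha> * r))))\<^sup>2"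
      by (rule power_mono) simp
    also have "\<dots> = sa\<^sup>2 / \<alpha>\<^sup>2 * (\<theta> ^ p)\<^sup>2 * (1 / r\<^sup>2) * (\<Sum>j\<in>J. norm (d j))\<^sup>2"
      by (simp add: power_mult_distrib power_divide)
    also have "\<dots> \<le> sa\<^sup>2 / \<alpha>\<^sup>2 * (\<theta> ^ p)\<^sup>2 * (1 / r\<^sup>2) * (S * real (card J))"
      unfolding S_def by (intro mult_left_mono sum_squared_le_sum_of_squares) (auto simp: finJ)
    also have "\<dots> = C p * S * (1 / r\<^sup>2)"
      by (simp add: C_def cardJ n_def mult_ac)
    finally show ?thesis unfolding r_def .
  qed
  \<comment> \<open>The equations hold at \<open>t = 0\<close> only. Continuity keeps the finitely
    many window terms below \<open>\<delta> / 2 * S\<close> on a short interval, while the tail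
    bound is uniform over the period; each takes half of the budget.\<close>
  define \<Phi> where "\<Phi> t = (\<Sum>m\<in>{- M..M}. (norm (fiber_value t d J m))\<^sup>2)" for t
  have \<Phi>_cont: "continuous_on UNIV \<Phi>"
    unfolding \<Phi>_def fiber_value_def
    by (intro continuous_intros continuous_on_compose2[OF continuous_window[of UNIV]]) auto
  have \<Phi>_0: "\<Phi> 0 = 0" by (simp add: \<Phi>_def kill)
  have \<delta>S: "\<delta> / 2 * S > 0" using \<delta> S by simp
  obtain \<eta>0 where \<eta>0: "\<eta>0 > 0" "\<forall>t\<in>UNIV. dist t 0 < \<eta>0 \<longrightarrow> dist (\<Phi> t) (\<Phi> 0) < \<delta> / 2 * S"
    using \<Phi>_cont[unfolded continuous_on_iff] \<delta>S by blast
  have \<Phi>_small: "\<Phi> t < \<delta> / 2 * S" if "\<bar>t\<bar> < \<eta>0" for t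
    using \<eta>0(2)[rule_format, of t] that abs_ge_self[of "\<Phi> t"] by (simp add: dist_real_def \<Phi>_0)
  define \<eta> where "\<eta> = min \<eta>0 L"
  have \<eta>: "0 < \<eta>" "\<eta> \<le> L" using \<eta>0(1) L by (auto simp: \<eta>_def)
  have small: "(\<integral>\<^sup>+m. ennreal ((norm (fiber_value t d J m))\<^sup>2) \<partial>count_space UNIV) \<le> ennreal (\<delta> * S)"
    if t: "t \<in> {0..<\<eta>}" for t
  proof -
    let ?fv = "\<lambda>m. (norm (fiber_value t d J m))\<^sup>2"
    let ?\<chi> = "\<lambda>m :: int. ennreal (1 / (of_int m)\<^sup>2)"
    have tL: "t \<in> {0..<L}" and t\<eta>: "\<bar>t\<bar> < \<eta>0" using t by (auto simp: \<eta>_def)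
    have CS: "C p * S \<ge> 0" using C0 S by simp
    have shift: "(\<integral>\<^sup>+m. ?\<chi> (m + s) \<partial>count_space UNIV) = ennreal Z" for s
      unfolding Z(2)[symmetric]
      by (rule nn_integral_bij_count_space) (auto intro!: bij_betwI[where g = "\<lambda>m. m - s"])
    \<comment> \<open>Outside the window one of the two translates equals
      \<open>1 / (|m| - M)\<^sup>2\<close>; adding the other gives one formula for both signs of
      \<open>m\<close>. Each translate has total mass \<open>Z\<close>.\<close>
    have "ennreal (?fv m) \<le> (if m \<in> {- M..M} then ennreal (?fv m) else 0) + ennreal (C p * S) * (?\<chi> (m + (- M)) + ?\<chi> (m + M))" for m
    proof (cases "m \<in> {- M..M}")
      case False
      then have m: "M < \<bar>m\<bar>" by auto
      have "ennreal (?fv m) \<le> ennreal (C p * S * (1 / (of_int (\<bar>m\<bar> - M))\<^sup>2))"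
        by (rule ennreal_leI) (rule tail[OF tL m])
      also have "\<dots> = ennreal (C p * S) * ?\<chi> (\<bar>m\<bar> - M)"
        using CS by (rule ennreal_mult')
      also have "?\<chi> (\<bar>m\<bar> - M) \<le> ?\<chi> (m + (- M)) + ?\<chi> (m + M)"
      proof (cases "m \<ge> 0")
        case False
        then have "(real_of_int (\<bar>m\<bar> - M))\<^sup>2 = (real_of_int (m + M))\<^sup>2"
          by (simp add: power2_eq_square algebra_simps)
        then show ?thesis by (simp add: add_increasing)
      qed (simp add: add_increasing2)
      then have "ennreal (C p * S) * ?\<chi> (\<bar>m\<bar> - M) \<le> ennreal (C p * S) * (?\<chi> (m + (- M)) + ?\<chi> (m + M))"
        by (rule mult_left_mono) simp
      finally show ?thesis using False by simp
    qed simp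
    then have "(\<integral>\<^sup>+m. ennreal (?fv m) \<partial>count_space UNIV) \<le>
      (\<integral>\<^sup>+m. (if m \<in> {- M..M} then ennreal (?fv m) else 0) + ennreal (C p * S) * (?\<chi> (m + (- M)) + ?\<chi> (m + M)) \<partial>count_space UNIV)"
      by (intro nn_integral_mono)
    also have "\<dots> = (\<integral>\<^sup>+m. (if m \<in> {- M..M} then ennreal (?fv m) else 0) \<partial>count_space UNIV)
        + ennreal (C p * S) * ((\<integral>\<^sup>+m. ?\<chi> (m + (- M)) \<partial>count_space UNIV) + (\<integral>\<^sup>+m. ?\<chi> (m + M) \<partial>count_space UNIV))"
      by (simp add: nn_integral_add nn_integral_cmult)
    also have "(\<integral>\<^sup>+m. (if m \<in> {- M..M} then ennreal (?fv m) else 0) \<partial>count_space UNIV) = ennreal (\<Phi> t)"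
      unfolding \<Phi>_def
      by (subst nn_integral_count_space'[where A = "{- M..M}"]) (auto simp: sum_ennreal)
    also have "ennreal (\<Phi> t) + ennreal (C p * S) * ((\<integral>\<^sup>+m. ?\<chi> (m + (- M)) \<partial>count_space UNIV) + (\<integral>\<^sup>+m. ?\<chi> (m + M) \<partial>count_space UNIV))
       = ennreal (\<Phi> t + C p * S * (Z + Z))"
    proof -
      have "\<Phi> t \<ge> 0" unfolding \<Phi>_def by (simp add: sum_nonneg)
      moreover have "ennreal Z + ennreal Z = ennreal (Z + Z)" by (rule ennreal_plus[symmetric, OF Z(1) Z(1)])
      ultimately show ?thesis unfolding shift using CS Z(1) by (simp only: ennreal_mult'[symmetric]) (simp flip: ennreal_plus)
    qed
    also have "\<dots> \<le> ennreal (\<delta> * S)"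
    proof (rule ennreal_leI)
      have "C p * (2 * Z) * S \<le> \<delta> / 2 * S" using p(1) S by (intro mult_right_mono) auto
      then show "\<Phi> t + C p * S * (Z + Z) \<le> \<delta> * S"
        using \<Phi>_small[OF t\<eta>] by (simp add: algebra_simps)
    qed
    finally show ?thesis .
  qed
  show ?thesis by (rule that[OF finJ S[unfolded S_def] \<eta> small[unfolded S_def]])
qed

theorem not_gabor_frame_if_sparse:
  assumes sparse: "L < \<alpha>"
  shows "\<not> gabor_frame g \<alpha> (1/L)"
proof
  assume "gabor_frame g \<alpha> (1/L)"
  then obtain A where A: "A > 0" and fr: "\<And>f. f \<in> L2 \<Longrightarrow>
      (\<lambda>(m, n). (norm (L2_inner f (gabor_atom g \<alpha> (1/L) m n)))\<^sup>2) summable_on UNIV \<and>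
      A * L2_norm_sq f \<le> (\<Sum>\<^sub>\<infinity>(m, n). (norm (L2_inner f (gabor_atom g \<alpha> (1/L) m n)))\<^sup>2)"
    unfolding gabor_frame_def by blast
  \<comment> \<open>Chosen so that the energy is at most \<open>L * \<delta> = A / 2\<close> times
    the squared norm, half of the presumed lower bound.\<close>
  define \<delta> where "\<delta> = A / (2 * L)"
  have \<delta>: "\<delta> > 0" using A L by (simp add: \<delta>_def)
  obtain J d \<eta> where J: "finite J" "0 < (\<Sum>j\<in>J. (norm (d j))\<^sup>2)" "0 < \<eta>" "\<eta> \<le> L"
    "\<And>t. t \<in> {0..<\<eta>} \<Longrightarrow>
      (\<integral>\<^sup>+m. ennreal ((norm (fiber_value t d J m))\<^sup>2) \<partial>count_space UNIV) \<le> ennreal (\<delta> * (\<Sum>j\<in>J. (norm (d j))\<^sup>2))"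
    using small_fiber_energy[OF sparse \<delta>] by blast
  obtain f where f: "f \<in> L2" "L2_norm_sq f = \<eta> * (\<Sum>j\<in>J. (norm (d j))\<^sup>2)"
    "(\<integral>\<^sup>+p. ennreal (case p of (m, n) \<Rightarrow> (norm (L2_inner f (gabor_atom g \<alpha> (1/L) m n)))\<^sup>2) \<partial>count_space UNIV)
       \<le> ennreal (L * \<delta> * L2_norm_sq f)"
    using step_function_energy[OF J(1,3,4,5) less_imp_le[OF \<delta>]] by blast
  let ?h = "\<lambda>(m, n). (norm (L2_inner f (gabor_atom g \<alpha> (1/L) m n)))\<^sup>2"
  have pos: "L2_norm_sq f > 0" using f(2) J by simp
  have i0: "infsum ?h UNIV \<ge> 0" by (rule infsum_nonneg) auto
  have "(\<integral>\<^sup>+p. ennreal (?h p) \<partial>count_space UNIV) = ennreal (infsum ?h UNIV)"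
    by (rule nn_integral_count_space_has_sum[THEN iffD2]) (use fr[OF f(1)] i0 in auto)
  then have "ennreal (infsum ?h UNIV) \<le> ennreal (L * \<delta> * L2_norm_sq f)" using f(3) by simp
  then have "infsum ?h UNIV \<le> L * \<delta> * L2_norm_sq f"
    using L \<delta> pos by (subst (asm) ennreal_le_iff) auto
  also have "\<dots> = A / 2 * L2_norm_sq f" using L by (simp add: \<delta>_def)
  finally have "A * L2_norm_sq f \<le> A / 2 * L2_norm_sq f" using fr[OF f(1)] by linarith
  then show False using A pos by (simp add: mult_le_cancel_right)
qed

end

theorem theorem1p1:
  fixes N :: nat and a w :: "nat \<Rightarrow> real" and g :: "real \<Rightarrow> complex"
  assumes "N \<ge> 1"
    and "\<And>k. k \<in> {1..N} \<Longrightarrow> a k > 0"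
    and "\<And>k. k \<in> {1..N} \<Longrightarrow> w k > 0"
    and "\<And>t. g t = (\<Sum>k=1..N. of_real (a k) / (of_real t - \<i> * of_real (w k)))"
  shows "frame_set g = {(\<alpha>, \<beta>). 0 < \<alpha> \<and> 0 < \<beta> \<and> \<alpha> * \<beta> \<le> 1}"
proof -
  have "gabor_frame g \<alpha> \<beta> \<longleftrightarrow> \<alpha> * \<beta> \<le> 1" if "0 < \<alpha>" "0 < \<beta>" for \<alpha> \<beta>
  proof -
    \<comment> \<open>With \<open>L = 1 / \<beta>\<close> the modulation step \<open>1 / L\<close>
      is \<beta>, and \<open>\<alpha> * \<beta> \<le> 1\<close> becomes
      \<open>\<alpha> \<le> L\<close>, so the critical case falls on the frame side.\<close>
    interpret herglotz_window N a w g \<alpha> "1 / \<beta>"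
      by unfold_locales (use assms that in auto)
    have "\<alpha> * \<beta> \<le> 1 \<longleftrightarrow> \<alpha> \<le> 1 / \<beta>" using that by (simp add: field_simps)
    then show ?thesis
      using gabor_frame_if_dense not_gabor_frame_if_sparse by (auto simp: not_le)
  qed
  then show ?thesis by (auto simp: frame_set_def)
qed

end
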